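(* Let $\boldsymbol d=\boldsymbol{\Pi}^0_3\setminus\boldsymbol{\Delta}^0_3$ be the Wadge degree of the complete $\boldsymbol{\Pi}^0_3$ subsets of $2^\omega$, and $\mathscr W_{\boldsymbol d}=\{[A]\in\mathrm{MALG}:\Phi(A)\in\boldsymbol d\}$. Then $\mathscr W_{\boldsymbol d}$ is dense in $\mathrm{MALG}$ in the sense of forcing: for every $[A]\in\mathrm{MALG}$ with $\mu(A)>0$ there is $[B]\in\mathscr W_{\boldsymbol d}$ with $\mu(B)>0$ and $\mu(B\setminus A)=0$. Moreover $\boldsymbol d$ is the unique Wadge degree $\boldsymbol e$ for which $\mathscr W_{\boldsymbol e}=\{[A]:\Phi(A)\in\boldsymbol e\}$ is dense in this sense.
   Context: $2^\omega$ is the Cantor space; $N_s=\{x:s\subset x\}$; $\mu$ is the coin-tossing measure, $\mu(N_s)=2^{-\mathrm{lh}(s)}$. $\Phi(A)=\{x:\lim_n\mu(A\cap N_{x\restriction n})/\mu(N_{x\restriction n})=1\}$. $\mathrm{MALG}$ is the measure algebra of measurable sets modulo null sets, partially ordered by $[A]\le[B]\iff\mu(A\setminus B)=0$, with least element $0=[\emptyset]$. A set $D\subseteq\mathrm{MALG}\setminus\{0\}$ is dense in the sense of forcing if every $b\in\mathrm{MALG}\setminus\{0\}$ has some $d\in D$ with $d\le b$. $\boldsymbol{\Pi}^0_3$: $F_{\sigma\delta}$ sets; $\boldsymbol{\Delta}^0_3$: sets both $F_{\sigma\delta}$ and $G_{\delta\sigma}$. A Wadge degree is an equivalence class under $X\equiv_W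 Y$, where $X\le_W Y$ iff $X=f^{-1}(Y)$ for a continuous $f:2^\omega\to2^\omega$. *)

theory Defs
  imports "HOL-Probability.Probability"
begin

definition nbhd :: "bool list \<Rightarrow> (nat \<Rightarrow> bool) set" where
  "nbhd s = {x. \<forall>i<length s. x i = s ! i}"

definition restr :: "(nat \<Rightarrow> bool) \<Rightarrow> nat \<Rightarrow> bool list" where
  "restr x n = map x [0..<n]"

definition mu :: "(nat \<Rightarrow> bool) measure" where
  "mu = (\<Pi>\<^sub>M i\<in>(UNIV::nat set). measure_pmf (bernoulli_pmf (1/2)))"

definition Phi :: "(nat \<Rightarrow> bool) set \<Rightarrow> (nat \<Rightarrow> bool) set" where
  "Phi A = {x. (\<lambda>n. measure mu (A \<inter> nbhd (restr x n)) / measure mu (nbhd (restr x n)))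
               \<longlonglongrightarrow> 1}"

definition cantor_open :: "(nat \<Rightarrow> bool) set \<Rightarrow> bool" where
  "cantor_open U \<longleftrightarrow> (\<forall>x\<in>U. \<exists>n. nbhd (restr x n) \<subseteq> U)"

definition cantor_closed :: "(nat \<Rightarrow> bool) set \<Rightarrow> bool" where
  "cantor_closed F \<longleftrightarrow> cantor_open (- F)"

definition Sigma02 :: "(nat \<Rightarrow> bool) set \<Rightarrow> bool" where
  "Sigma02 X \<longleftrightarrow> (\<exists>F :: nat \<Rightarrow> (nat \<Rightarrow> bool) set. (\<forall>n. cantor_closed (F n)) \<and> X = (\<Union>n. F n))"

definition Pi03 :: "(nat \<Rightarrow> bool) set \<Rightarrow> bool" where
  "Pi03 X \<longleftrightarrow> (\<exists>G :: nat \<Rightarrow> (nat \<Rightarrow> bool) set. (\<forall>n. Sigma02 (G n)) \<and> X = (\<Inter>n. G n))"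

definition Delta03 :: "(nat \<Rightarrow> bool) set \<Rightarrow> bool" where
  "Delta03 X \<longleftrightarrow> Pi03 X \<and> Pi03 (- X)"

definition cantor_continuous :: "((nat \<Rightarrow> bool) \<Rightarrow> (nat \<Rightarrow> bool)) \<Rightarrow> bool" where
  "cantor_continuous f \<longleftrightarrow> (\<forall>U. cantor_open U \<longrightarrow> cantor_open (f -` U))"

definition wadge_le :: "(nat \<Rightarrow> bool) set \<Rightarrow> (nat \<Rightarrow> bool) set \<Rightarrow> bool" where
  "wadge_le X Y \<longleftrightarrow> (\<exists>f. cantor_continuous f \<and> X = f -` Y)"

definition wadge_eq :: "(nat \<Rightarrow> bool) set \<Rightarrow> (nat \<Rightarrow> bool) set \<Rightarrow> bool" where
  "wadge_eq X Y \<longleftrightarrow> wadge_le X Y \<and> wadge_le Y X"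

definition is_wadge_degree :: "(nat \<Rightarrow> bool) set set \<Rightarrow> bool" where
  "is_wadge_degree e \<longleftrightarrow> (\<exists>X. e = {Y. wadge_eq Y X})"

definition d_Pi03 :: "(nat \<Rightarrow> bool) set set" where
  "d_Pi03 = {X. Pi03 X \<and> \<not> Delta03 X}"

text \<open>W_e is dense in MALG in the sense of forcing (stated on representatives;
  Phi only depends on the class of A modulo null sets).\<close>
definition W_dense :: "(nat \<Rightarrow> bool) set set \<Rightarrow> bool" where
  "W_dense e \<longleftrightarrow> (\<forall>A\<in>sets mu. measure mu A > 0 \<longrightarrow>
      (\<exists>B\<in>sets mu. measure mu B > 0 \<and> measure mu (B - A) = 0 \<and> Phi B \<in> e))"

end

theory Submission
  imports Defs
begin

text \<open>Every \<open>\<Pi>\<^sup>0\<^sub>3\<close> set \<open>Y\<close> has the form \<open>{x. \<alpha> x t \<rightarrow> \<infinity>}\<close> with \<open>\<alpha> x t\<close> depending on finitely many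
  bits of \<open>x\<close>, so a reduction of \<open>Y\<close> to \<open>X\<close> may be described as a strategy that answers a
  sequence of naturals by a growing node of the binary tree.

  If \<open>X\<close> is \<open>\<Pi>\<^sup>0\<^sub>3\<close> but not \<open>\<Sigma>\<^sup>0\<^sub>3\<close>, such a strategy exists without any appeal to determinacy.
  Call \<open>S\<close> thin if a \<open>\<Sigma>\<^sup>0\<^sub>3\<close> set separates \<open>X \<inter> S\<close> from \<open>- X\<close>; thin sets form a
  \<open>\<sigma>\<close>-ideal. If \<open>- X = (\<Union>k. B k)\<close> and the closed set \<open>C\<close> is not thin, then some \<open>B k \<inter> C\<close> is not
  covered by countably many closed thin sets (otherwise \<open>C\<close> would be the union of a thin set and of a
  \<open>G\<^sub>\<delta>\<close> subset of \<open>X\<close>), which yields a closed \<open>C' \<subseteq> C\<close>, nowhere locally thin, in which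
  \<open>B k\<close> is dense. Moving towards \<open>B k\<close> inside \<open>C'\<close> or shrinking \<open>C'\<close> are both always possible.

  If \<open>B\<close> has positive measure and is null on a dense open set, then no node has density \<open>1\<close>, and
  from density near \<open>1\<close> one can let the density of \<open>B\<close> drop to about \<open>1 - \<epsilon>\<close> and recover, without
  ever falling below \<open>1 - 4\<epsilon>\<close>. These oscillations show that \<open>Phi B\<close> is \<open>\<Pi>\<^sup>0\<^sub>3\<close>-hard. Since every
  set of positive measure contains such a \<open>B\<close>, and every non-null subset of the complement of a small
  dense open set is one, both density and uniqueness follow.\<close>

section \<open>The Borel hierarchy of Cantor space\<close>

lemma mem_nbhd_restr: "y \<in> nbhd (restr x n) \<longleftrightarrow> (\<forall>i<n. y i = x i)"
  by (auto simp: nbhd_def restr_def)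

lemma length_restr [simp]: "length (restr x n) = n"
  by (simp add: restr_def)

lemma restr_in_nbhd [simp]: "x \<in> nbhd (restr x n)"
  by (simp add: mem_nbhd_restr)

lemma restr_eq_take:
  assumes "y \<in> nbhd s" "n \<le> length s"
  shows "restr y n = take n s"
  using assms by (auto simp: nbhd_def restr_def intro!: nth_equalityI)

lemma nbhd_eq_restr: "x \<in> nbhd s \<Longrightarrow> nbhd s = nbhd (restr x (length s))"
  by (simp add: restr_eq_take)

lemma nbhd_take: "nbhd s \<subseteq> nbhd (take n s)"
  by (auto simp: nbhd_def)

lemma nbhd_append: "nbhd (s @ u) \<subseteq> nbhd s"
  using nbhd_take[of "s @ u" "length s"] by simp

lemma nbhd_restr_mono: "m \<le> n \<Longrightarrow> nbhd (restr x n) \<subseteq> nbhd (restr x m)"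
  by (auto simp: mem_nbhd_restr)

lemma nbhd_cases:
  assumes "nbhd s \<inter> nbhd r \<noteq> {}"
  shows "nbhd s \<subseteq> nbhd r \<or> nbhd r \<subseteq> nbhd s"
proof -
  obtain x where x: "x \<in> nbhd s" "x \<in> nbhd r" using assms by blast
  show ?thesis
    using nbhd_eq_restr[OF x(1)] nbhd_eq_restr[OF x(2)]
    by (metis linear nbhd_restr_mono)
qed

lemma nbhd_subset_length:
  assumes "nbhd r \<subseteq> nbhd s"
  shows "length s \<le> length r \<and> take (length s) r = s"
proof -
  define x where "x = (\<lambda>i. if i < length r then r ! i else \<not> s ! i)"
  have xr: "x \<in> nbhd r" by (simp add: x_def nbhd_def)
  then have xs: "x \<in> nbhd s" using assms by blast
  have len: "length s \<le> length r"
  proof (rule ccontr)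
    assume "\<not> length s \<le> length r"
    then have "x (length r) = s ! length r" using xs by (simp add: nbhd_def)
    then show False by (simp add: x_def)
  qed
  then show ?thesis using restr_eq_take[OF xr len] restr_eq_take[OF xs, of "length s"] by simp
qed

lemma nbhd_open: "cantor_open (nbhd s)"
  unfolding cantor_open_def using nbhd_eq_restr by blast

lemma nbhd_closed: "cantor_closed (nbhd s)"
  unfolding cantor_closed_def cantor_open_def
proof
  fix x assume "x \<in> - nbhd s"
  then obtain i where "i < length s" "x i \<noteq> s ! i" by (auto simp: nbhd_def)
  then have "y \<notin> nbhd s" if "y \<in> nbhd (restr x (Suc i))" for y
    using that unfolding mem_nbhd_restr by (auto simp: nbhd_def)
  then have "nbhd (restr x (Suc i)) \<subseteq> - nbhd s" by blast
  then show "\<exists>n. nbhd (restr x n) \<subseteq> - nbhd s" by blast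
qed

lemma open_Int: "cantor_open U \<Longrightarrow> cantor_open V \<Longrightarrow> cantor_open (U \<inter> V)"
  unfolding cantor_open_def
proof
  fix x assume "\<forall>x\<in>U. \<exists>n. nbhd (restr x n) \<subseteq> U" "\<forall>x\<in>V. \<exists>n. nbhd (restr x n) \<subseteq> V" "x \<in> U \<inter> V"
  then obtain n m where "nbhd (restr x n) \<subseteq> U" "nbhd (restr x m) \<subseteq> V" by blast
  then have "nbhd (restr x (max n m)) \<subseteq> U \<inter> V"
    using nbhd_restr_mono[of n "max n m" x] nbhd_restr_mono[of m "max n m" x] by auto
  then show "\<exists>n. nbhd (restr x n) \<subseteq> U \<inter> V" by blast
qed

lemma open_UN: "(\<And>i. i \<in> I \<Longrightarrow> cantor_open (U i)) \<Longrightarrow> cantor_open (\<Union>i\<in>I. U i)"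
  unfolding cantor_open_def
proof
  fix x assume *: "\<And>i. i \<in> I \<Longrightarrow> \<forall>x\<in>U i. \<exists>n. nbhd (restr x n) \<subseteq> U i" and "x \<in> (\<Union>i\<in>I. U i)"
  then obtain i where i: "i \<in> I" "x \<in> U i" by blast
  then obtain n where "nbhd (restr x n) \<subseteq> U i" using * by blast
  then show "\<exists>n. nbhd (restr x n) \<subseteq> (\<Union>i\<in>I. U i)" using i by blast
qed

lemma closed_Un: "cantor_closed F \<Longrightarrow> cantor_closed G \<Longrightarrow> cantor_closed (F \<union> G)"
  unfolding cantor_closed_def by (simp add: open_Int)

lemma closed_INT: "(\<And>i. i \<in> I \<Longrightarrow> cantor_closed (F i)) \<Longrightarrow> cantor_closed (\<Inter>i\<in>I. F i)"
  unfolding cantor_closed_def using open_UN[of I "\<lambda>i. - F i"] by simp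

lemma closed_Int: "cantor_closed F \<Longrightarrow> cantor_closed G \<Longrightarrow> cantor_closed (F \<inter> G)"
  using closed_INT[of "{F, G}" "\<lambda>x. x"] by auto

lemma closed_empty [simp]: "cantor_closed {}"
  by (simp add: cantor_closed_def cantor_open_def)

lemma closed_UNIV [simp]: "cantor_closed UNIV"
  by (simp add: cantor_closed_def cantor_open_def)

lemma closed_notin:
  assumes "cantor_closed F" "x \<notin> F"
  shows "\<exists>n. nbhd (restr x n) \<inter> F = {}"
proof -
  obtain n where "nbhd (restr x n) \<subseteq> - F"
    using assms unfolding cantor_closed_def cantor_open_def by blast
  then show ?thesis by blast
qed

lemma closed_mem:
  assumes "cantor_closed F" "\<And>n. \<exists>m\<ge>n. nbhd (restr x m) \<inter> F \<noteq> {}"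
  shows "x \<in> F"
proof (rule ccontr)
  assume "x \<notin> F"
  then obtain n where n: "nbhd (restr x n) \<inter> F = {}" using closed_notin[OF assms(1)] by blast
  obtain m where "m \<ge> n" "nbhd (restr x m) \<inter> F \<noteq> {}" using assms(2) by blast
  then show False using n nbhd_restr_mono[of n m x] by blast
qed

lemma open_eq_UN: "cantor_open U \<Longrightarrow> U = (\<Union>s\<in>{s. nbhd s \<subseteq> U}. nbhd s)"
  unfolding cantor_open_def using restr_in_nbhd by blast

lemma Sigma02_countable:
  assumes "countable D" "\<And>F. F \<in> D \<Longrightarrow> cantor_closed F"
  shows "Sigma02 (\<Union>D)"
proof (cases "D = {}")
  case True
  then show ?thesis unfolding Sigma02_def by (auto intro!: exI[of _ "\<lambda>_. {}"])
next
  case False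
  then show ?thesis unfolding Sigma02_def
    using assms by (intro exI[of _ "from_nat_into D"]) (auto simp: from_nat_into range_from_nat_into)
qed

lemma Sigma02_UN:
  assumes "\<And>i::nat. Sigma02 (S i)"
  shows "Sigma02 (\<Union>i. S i)"
proof -
  obtain F :: "nat \<Rightarrow> nat \<Rightarrow> _" where F: "\<And>i n. cantor_closed (F i n)" "\<And>i. S i = (\<Union>n. F i n)"
    using assms unfolding Sigma02_def by metis
  have "(\<Union>i. S i) = \<Union>(range (\<lambda>(i, n). F i n))" using F(2) by auto
  then show ?thesis using F(1) by (auto intro!: Sigma02_countable)
qed

lemma closed_Sigma02: "cantor_closed F \<Longrightarrow> Sigma02 F"
  unfolding Sigma02_def by (intro exI[of _ "\<lambda>_. F"]) auto

lemma open_Sigma02: 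
  assumes "cantor_open U" shows "Sigma02 U"
proof -
  have "Sigma02 (\<Union>(nbhd ` {s. nbhd s \<subseteq> U}))"
    by (rule Sigma02_countable) (auto simp: nbhd_closed)
  then show ?thesis using open_eq_UN[OF assms] by simp
qed

lemma Sigma02_Un: 
  assumes "Sigma02 S" "Sigma02 T" shows "Sigma02 (S \<union> T)"
proof -
  have "Sigma02 (\<Union>i::nat. if i = 0 then S else T)" using assms by (intro Sigma02_UN) auto
  moreover have "(\<Union>i::nat. if i = 0 then S else T) = S \<union> T" by (auto split: if_splits)
  ultimately show ?thesis by simp
qed

lemma Sigma02_Pi03: "Sigma02 S \<Longrightarrow> Pi03 S"
  unfolding Pi03_def by (intro exI[of _ "\<lambda>_. S"]) auto

lemma Pi03_INT:
  assumes "\<And>i::nat. Pi03 (S i)"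
  shows "Pi03 (\<Inter>i. S i)"
proof -
  obtain G :: "nat \<Rightarrow> nat \<Rightarrow> _" where G: "\<And>i n. Sigma02 (G i n)" "\<And>i. S i = (\<Inter>n. G i n)"
    using assms unfolding Pi03_def by metis
  have "(\<Inter>i. S i) = (\<Inter>k. case prod_decode k of (i, n) \<Rightarrow> G i n)"
  proof (intro equalityI subsetI)
    fix x assume x: "x \<in> (\<Inter>k. case prod_decode k of (i, n) \<Rightarrow> G i n)"
    have "x \<in> G i n" for i n using INT_D[OF x, of "prod_encode (i, n)"] by simp
    then show "x \<in> (\<Inter>i. S i)" using G(2) by auto
  qed (use G(2) in \<open>auto split: prod.splits\<close>)
  then show ?thesis unfolding Pi03_def using G(1)
    by (auto intro!: exI[of _ "\<lambda>k. case prod_decode k of (i, n) \<Rightarrow> G i n"] split: prod.splits)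
qed

lemma Pi03_closed_family:
  "Pi03 X \<longleftrightarrow> (\<exists>F :: nat \<Rightarrow> nat \<Rightarrow> _. (\<forall>n m. cantor_closed (F n m)) \<and> X = (\<Inter>n. \<Union>m. F n m))"
proof
  assume "Pi03 X"
  then obtain G :: "nat \<Rightarrow> _" where G: "\<And>n. Sigma02 (G n)" "X = (\<Inter>n. G n)" unfolding Pi03_def by blast
  then obtain F :: "nat \<Rightarrow> nat \<Rightarrow> _" where "\<And>n m. cantor_closed (F n m)" "\<And>n. G n = (\<Union>m. F n m)"
    unfolding Sigma02_def by metis
  then show "\<exists>F :: nat \<Rightarrow> nat \<Rightarrow> _. (\<forall>n m. cantor_closed (F n m)) \<and> X = (\<Inter>n. \<Union>m. F n m)"
    using G(2) by auto
next
  assume "\<exists>F :: nat \<Rightarrow> nat \<Rightarrow> _. (\<forall>n m. cantor_closed (F n m)) \<and> X = (\<Inter>n. \<Union>m. F n m)"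
  then obtain F :: "nat \<Rightarrow> nat \<Rightarrow> _" where "\<forall>n m. cantor_closed (F n m)" "X = (\<Inter>n. \<Union>m. F n m)"
    by blast
  then show "Pi03 X" unfolding Pi03_def Sigma02_def
    by (intro exI[of _ "\<lambda>n. \<Union>m. F n m"]) auto
qed

lemma closed_vimage:
  "cantor_continuous f \<Longrightarrow> cantor_closed F \<Longrightarrow> cantor_closed (f -` F)"
  unfolding cantor_continuous_def cantor_closed_def using vimage_Compl[of f F] by metis

lemma Pi03_vimage:
  assumes "cantor_continuous f" "Pi03 X" shows "Pi03 (f -` X)"
proof -
  obtain F :: "nat \<Rightarrow> nat \<Rightarrow> _" where "\<forall>n m. cantor_closed (F n m)" "X = (\<Inter>n. \<Union>m. F n m)"
    using assms(2) unfolding Pi03_closed_family by blast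
  then have "\<forall>n m. cantor_closed (f -` F n m)" "f -` X = (\<Inter>n. \<Union>m. f -` F n m)"
    using closed_vimage[OF assms(1)] by auto
  then show ?thesis unfolding Pi03_closed_family by (intro exI conjI)
qed

lemma Pi03_wadge_le: "wadge_le Y X \<Longrightarrow> Pi03 X \<Longrightarrow> Pi03 Y"
  unfolding wadge_le_def using Pi03_vimage by blast

lemma wadge_le_Compl: "wadge_le Y X \<Longrightarrow> wadge_le (- Y) (- X)"
  unfolding wadge_le_def by (auto simp: vimage_Compl)

lemma Lipschitz_continuous:
  assumes "\<And>x y n. (\<forall>i<n. x i = y i) \<Longrightarrow> (\<forall>i<n. f x i = f y i)"
  shows "cantor_continuous f"
  unfolding cantor_continuous_def cantor_open_def
proof (intro allI impI ballI)
  fix U x assume "\<forall>x\<in>U. \<exists>n. nbhd (restr x n) \<subseteq> U" "x \<in> f -` U"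
  then obtain n where n: "nbhd (restr (f x) n) \<subseteq> U" by auto
  have "f y \<in> nbhd (restr (f x) n)" if "y \<in> nbhd (restr x n)" for y
    using assms[of n y x] that by (simp add: mem_nbhd_restr)
  then show "\<exists>n. nbhd (restr x n) \<subseteq> f -` U" using n by blast
qed

section \<open>Coding \<open>Pi03\<close> sets by diverging sequences, and reductions by
  strategies\<close>

lemma filterlim_nat_at_top:
  "filterlim a at_top sequentially \<longleftrightarrow> (\<forall>N::nat. \<exists>T. \<forall>t\<ge>T. N \<le> a t)"
  by (simp add: filterlim_at_top eventually_sequentially)

lemma mono_bounded_nat_eventually_const:
  fixes p :: "nat \<Rightarrow> nat"
  assumes "\<And>t. p t \<le> p (Suc t)" "\<And>t. p t \<le> m"
  shows "\<exists>T. \<forall>t\<ge>T. p t = p T"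
proof -
  have fin: "finite (range p)" using assms(2) by (auto intro: finite_subset[of _ "{..m}"])
  then obtain T where T: "p T = Max (range p)" using Max_in[OF fin] by fastforce
  have "p t = p T" if "t \<ge> T" for t
    using lift_Suc_mono_le[of p, OF assms(1) that] Max_ge[OF fin, of "p t"] T by simp
  then show ?thesis by blast
qed

text \<open>After \<open>t\<close> bits, \<open>p x n t\<close> is the current guess of an
  \<open>m\<close> with \<open>x\<close> in \<open>F n m\<close>. Guesses only increase, and they
  settle iff some \<open>F n m\<close> contains \<open>x\<close>. The least \<open>n\<close> whose
  guess changes at time \<open>t\<close>, capped by \<open>t\<close>, is
  \<open>\<alpha> x t\<close>; it diverges iff every guess settles.\<close>

lemma Pi03_as_divergence:
  assumes "Pi03 Y"
  shows "\<exists>\<alpha> :: (nat \<Rightarrow> bool) \<Rightarrow> nat \<Rightarrow> nat.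
    (\<forall>x y t. (\<forall>i<Suc t. x i = y i) \<longrightarrow> \<alpha> x t = \<alpha> y t) \<and>
    (\<forall>x. x \<in> Y \<longleftrightarrow> filterlim (\<alpha> x) at_top sequentially)"
proof -
  obtain F :: "nat \<Rightarrow> nat \<Rightarrow> _" where F: "\<And>n m. cantor_closed (F n m)" "Y = (\<Inter>n. \<Union>m. F n m)"
    using assms unfolding Pi03_closed_family by blast
  define p where "p x n t = (LEAST m. m = t \<or> nbhd (restr x t) \<inter> F n m \<noteq> {})" for x n t
  define \<alpha> where "\<alpha> x t = (LEAST n. n = t \<or> p x n (Suc t) \<noteq> p x n t)" for x t
  have p: "p x n t = t \<or> nbhd (restr x t) \<inter> F n (p x n t) \<noteq> {}" for x n t
    unfolding p_def by (rule LeastI_ex, rule exI, rule disjI1, rule refl)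
  have p_le: "p x n t \<le> m" if "m = t \<or> nbhd (restr x t) \<inter> F n m \<noteq> {}" for x n t m
    unfolding p_def by (rule Least_le) (rule that)
  have p_mono: "p x n t \<le> p x n (Suc t)" for x n t
  proof (cases "p x n (Suc t) = Suc t")
    case True
    then show ?thesis using p_le[of t t x n] by simp
  next
    case False
    then have "nbhd (restr x t) \<inter> F n (p x n (Suc t)) \<noteq> {}"
      using p[of x n "Suc t"] nbhd_restr_mono[of t "Suc t" x] by auto
    then show ?thesis by (intro p_le disjI2)
  qed
  have p_cong: "p x n t = p y n t" if "\<forall>i<t. x i = y i" for x y n t
  proof -
    have "restr x t = restr y t" using that by (simp add: restr_def)
    then show ?thesis by (simp add: p_def)
  qed
  have \<alpha>: "\<alpha> x t = t \<or> p x (\<alpha> x t) (Suc t) \<noteq> p x (\<alpha> x t) t" for x t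
    unfolding \<alpha>_def by (rule LeastI_ex, rule exI, rule disjI1, rule refl)
  have \<alpha>_le: "\<alpha> x t \<le> n" if "p x n (Suc t) \<noteq> p x n t" for x t n
    unfolding \<alpha>_def by (rule Least_le) (rule disjI2, rule that)
  have iff: "x \<in> Y \<longleftrightarrow> filterlim (\<alpha> x) at_top sequentially" for x
  proof
    assume "x \<in> Y"
    then have "\<exists>m. x \<in> F n m" for n using F(2) by blast
    then obtain m where m: "\<And>n. x \<in> F n (m n)" by metis
    have "p x n t \<le> m n" for n t
      by (rule p_le) (use m[of n] restr_in_nbhd[of x t] in blast)
    then have "\<exists>T. \<forall>t\<ge>T. p x n t = p x n T" for n
      by (intro mono_bounded_nat_eventually_const p_mono)
    then obtain T where T: "\<And>n t. t \<ge> T n \<Longrightarrow> p x n t = p x n (T n)" by metis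
    show "filterlim (\<alpha> x) at_top sequentially"
      unfolding filterlim_nat_at_top
    proof
      fix N
      \<comment> \<open>Beyond \<open>S\<close> all guesses with index up to \<open>N\<close> have
        settled; \<open>N \<le> S\<close> also prevents the default value
        \<open>\<alpha> x t = t\<close> from being below \<open>N\<close>.\<close>
      define S where "S = Max (insert N (T ` {..N}))"
      have S: "N \<le> S" "\<And>n. n \<le> N \<Longrightarrow> T n \<le> S" unfolding S_def by (auto simp del: Max_insert intro!: Max_ge)
      have "N \<le> \<alpha> x t" if "t \<ge> S" for t
      proof (rule ccontr)
        assume "\<not> N \<le> \<alpha> x t"
        then have "T (\<alpha> x t) \<le> t" "\<alpha> x t \<noteq> t" using S(1) S(2)[of "\<alpha> x t"] that by auto
        then show False using T[of "\<alpha> x t" t] T[of "\<alpha> x t" "Suc t"] \<alpha>[of x t] by simp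
      qed
      then show "\<exists>T. \<forall>t\<ge>T. N \<le> \<alpha> x t" by blast
    qed
  next
    assume lim: "filterlim (\<alpha> x) at_top sequentially"
    show "x \<in> Y" unfolding F(2)
    proof
      fix n
      obtain T where "\<And>t. t \<ge> T \<Longrightarrow> Suc n \<le> \<alpha> x t"
        using lim unfolding filterlim_nat_at_top by blast
      then have const: "p x n (Suc t) = p x n t" if "t \<ge> T" for t
        using \<alpha>_le[of x n t] that by (metis not_less_eq_eq)
      have pT: "p x n t = p x n T" if "t \<ge> T" for t
        using that by (induction rule: dec_induct) (auto simp: const)
      have "x \<in> F n (p x n T)"
      proof (rule closed_mem[OF F(1)])
        fix k
        \<comment> \<open>Since \<open>m\<close> exceeds the settled guess, the default
          \<open>p x n m = m\<close> is excluded, so the guess is backed by a point of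
          \<open>F n (p x n T)\<close> near \<open>x\<close>.\<close>
        define m where "m = max k (max T (Suc (p x n T)))"
        have "m \<ge> T" "m > p x n T" "m \<ge> k" by (auto simp: m_def)
        then have "nbhd (restr x m) \<inter> F n (p x n T) \<noteq> {}" using p[of x n m] pT[of m] by auto
        then show "\<exists>m\<ge>k. nbhd (restr x m) \<inter> F n (p x n T) \<noteq> {}" using \<open>m \<ge> k\<close> by blast
      qed
      then show "x \<in> (\<Union>m. F n m)" by blast
    qed
  qed
  have cong: "\<alpha> x t = \<alpha> y t" if "\<forall>i<Suc t. x i = y i" for x y t
    using p_cong[of t x y] p_cong[of "Suc t" x y] that by (simp add: \<alpha>_def)
  show ?thesis using cong iff by (intro exI[of _ \<alpha>]) simp
qed

text \<open>A strategy answers the moves of \<open>\<alpha>\<close> by states whose nodes \<open>h\<close> grow; the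
  reduction sends a point to the branch through the nodes of its run.\<close>

lemma wadge_le_by_strategy:
  fixes h :: "'s \<Rightarrow> bool list" and R :: "nat \<Rightarrow> 's \<Rightarrow> 's \<Rightarrow> bool"
  assumes "Pi03 Y" "Inv st0"
    and step: "\<And>st n. Inv st \<Longrightarrow> \<exists>st'. Inv st' \<and> R n st st' \<and>
      length (h st) < length (h st') \<and> take (length (h st)) (h st') = h st"
    and win: "\<And>\<alpha> \<sigma> y. \<lbrakk>\<sigma> 0 = st0; \<And>t. Inv (\<sigma> t); \<And>t. R (\<alpha> t) (\<sigma> t) (\<sigma> (Suc t));
      \<And>t. length (h (\<sigma> t)) < length (h (\<sigma> (Suc t))); \<And>t. y \<in> nbhd (h (\<sigma> t))\<rbrakk> \<Longrightarrow>
      y \<in> X \<longleftrightarrow> filterlim \<alpha> at_top sequentially"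
  shows "wadge_le Y X"
proof -
  obtain \<alpha> :: "(nat \<Rightarrow> bool) \<Rightarrow> nat \<Rightarrow> nat"
    where *: "(\<forall>x y t. (\<forall>i<Suc t. x i = y i) \<longrightarrow> \<alpha> x t = \<alpha> y t) \<and>
      (\<forall>x. x \<in> Y \<longleftrightarrow> filterlim (\<alpha> x) at_top sequentially)"
    using Pi03_as_divergence[OF assms(1)] by (rule exE)
  have \<alpha>: "\<And>x y t. (\<forall>i<Suc t. x i = y i) \<Longrightarrow> \<alpha> x t = \<alpha> y t"
    and Y: "\<And>x. x \<in> Y \<longleftrightarrow> filterlim (\<alpha> x) at_top sequentially"
    using * by simp_all
  define nxt where "nxt n st = (SOME st'. Inv st' \<and> R n st st' \<and>
      length (h st) < length (h st') \<and> take (length (h st)) (h st') = h st)" for n st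
  have nxt: "Inv (nxt n st) \<and> R n st (nxt n st) \<and>
      length (h st) < length (h (nxt n st)) \<and> take (length (h st)) (h (nxt n st)) = h st"
    if "Inv st" for n st
    unfolding nxt_def by (rule someI_ex) (rule step[OF that])
  define \<sigma> where "\<sigma> x t = rec_nat st0 (\<lambda>t st. nxt (\<alpha> x t) st) t" for x t
  have \<sigma>_simps: "\<sigma> x 0 = st0" "\<sigma> x (Suc t) = nxt (\<alpha> x t) (\<sigma> x t)" for x t
    by (simp_all add: \<sigma>_def)
  have inv: "Inv (\<sigma> x t)" for x t
    by (induction t) (auto simp: \<sigma>_simps assms(2) nxt)
  have R: "R (\<alpha> x t) (\<sigma> x t) (\<sigma> x (Suc t))"
    and grow: "length (h (\<sigma> x t)) < length (h (\<sigma> x (Suc t)))"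
    and ext: "take (length (h (\<sigma> x t))) (h (\<sigma> x (Suc t))) = h (\<sigma> x t)" for x t
    using nxt[OF inv[of x t], of "\<alpha> x t"] by (simp_all add: \<sigma>_simps)
  have \<sigma>_cong: "(\<forall>i<t. x i = y i) \<Longrightarrow> \<sigma> x t = \<sigma> y t" for x y t
    by (induction t) (auto simp: \<sigma>_simps intro!: arg_cong2[where f=nxt] \<alpha>)
  have len: "t \<le> length (h (\<sigma> x t))" for x t
    by (induction t) (use grow in \<open>auto intro: order.strict_trans1 Suc_leI\<close>)
  have nth: "h (\<sigma> x t') ! i = h (\<sigma> x t) ! i" if "t \<le> t'" "i < length (h (\<sigma> x t))" for x t t' i
    using that
  proof (induction rule: dec_induct)
    case (step k)
    have "length (h (\<sigma> x t)) \<le> length (h (\<sigma> x k))"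
      using lift_Suc_mono_le[of "\<lambda>t. length (h (\<sigma> x t))", OF less_imp_le[OF grow] step(1)] by simp
    then have "h (\<sigma> x (Suc k)) ! i = h (\<sigma> x k) ! i"
      using ext[of x k] step.prems by (metis nth_take order.strict_trans2)
    then show ?case using step by simp
  qed simp
  \<comment> \<open>Nodes at time \<open>Suc i\<close> have length at least \<open>Suc i\<close>, so
    bit \<open>i\<close> is already decided. It depends only on the first \<open>Suc i\<close> bits
    of \<open>x\<close>, which makes \<open>f\<close> Lipschitz.\<close>
  define f where "f x i = h (\<sigma> x (Suc i)) ! i" for x i
  have fnbhd: "f x \<in> nbhd (h (\<sigma> x t))" for x t
    unfolding nbhd_def f_def
  proof clarify
    fix i assume i: "i < length (h (\<sigma> x t))"
    show "h (\<sigma> x (Suc i)) ! i = h (\<sigma> x t) ! i"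
      using nth[of t "Suc i" i x] nth[of "Suc i" t i x] i len[of "Suc i" x]
      by (cases "t \<le> Suc i") auto
  qed
  have "cantor_continuous f"
  proof (rule Lipschitz_continuous, intro allI impI)
    fix x y :: "nat \<Rightarrow> bool" and n i assume "\<forall>i<n. x i = y i" "i < n"
    then show "f x i = f y i" unfolding f_def by (subst \<sigma>_cong[of "Suc i" x y]) auto
  qed
  moreover have "Y = f -` X"
    using win[of "\<sigma> x" "\<alpha> x" "f x" for x, OF \<sigma>_simps(1) inv R grow fnbhd] Y by blast
  ultimately show ?thesis unfolding wadge_le_def by blast
qed

section \<open>Completeness of the proper \<open>\<Pi>\<^sup>0\<^sub>3\<close> sets\<close>

definition Sigma03_thin :: "(nat \<Rightarrow> bool) set \<Rightarrow> (nat \<Rightarrow> bool) set \<Rightarrow> bool" where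
  "Sigma03_thin X S \<longleftrightarrow> (\<exists>T. Pi03 (- T) \<and> X \<inter> S \<subseteq> T \<and> T \<subseteq> X)"

lemma thin_subset: "Sigma03_thin X S \<Longrightarrow> X \<inter> S' \<subseteq> S \<Longrightarrow> Sigma03_thin X S'"
  unfolding Sigma03_thin_def by blast

lemma thin_UN:
  assumes "\<And>i::nat. Sigma03_thin X (S i)"
  shows "Sigma03_thin X (\<Union>i. S i)"
proof -
  obtain T where T: "\<And>i. Pi03 (- T i)" "\<And>i. X \<inter> S i \<subseteq> T i" "\<And>i. T i \<subseteq> X"
    using assms unfolding Sigma03_thin_def by metis
  have "Pi03 (\<Inter>i. - T i)" by (rule Pi03_INT) (rule T(1))
  then have "Pi03 (- (\<Union>i. T i))" by simp
  then show ?thesis unfolding Sigma03_thin_def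
    using T(2,3) by (intro exI[of _ "\<Union>i. T i"]) blast
qed

lemma thin_empty [simp]: "Sigma03_thin X {}"
  unfolding Sigma03_thin_def
  by (intro exI[of _ "{}"]) (simp add: Sigma02_Pi03 closed_Sigma02)

lemma thin_countable:
  assumes "countable D" "\<And>S. S \<in> D \<Longrightarrow> Sigma03_thin X S"
  shows "Sigma03_thin X (\<Union>D)"
proof (cases "D = {}")
  case False
  then have "\<Union>D = (\<Union>i. from_nat_into D i)"
    using assms(1) by (metis range_from_nat_into)
  then show ?thesis
    using thin_UN[of X "from_nat_into D"] assms(2) False by (simp add: from_nat_into)
qed simp

lemma thin_Un: "Sigma03_thin X S \<Longrightarrow> Sigma03_thin X S' \<Longrightarrow> Sigma03_thin X (S \<union> S')"
  using thin_countable[of "{S, S'}" X] by auto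

definition closed_thin_cover :: "(nat \<Rightarrow> bool) set \<Rightarrow> (nat \<Rightarrow> bool) set \<Rightarrow> bool" where
  "closed_thin_cover X T \<longleftrightarrow>
    (\<exists>D. countable D \<and> (\<forall>F\<in>D. cantor_closed F \<and> Sigma03_thin X F) \<and> T \<subseteq> \<Union>D)"

lemma cover_countable:
  assumes "countable I" "\<And>i. i \<in> I \<Longrightarrow> closed_thin_cover X (T i)"
  shows "closed_thin_cover X (\<Union>i\<in>I. T i)"
proof -
  have "\<forall>i\<in>I. \<exists>D. countable D \<and> (\<forall>F\<in>D. cantor_closed F \<and> Sigma03_thin X F) \<and> T i \<subseteq> \<Union>D"
    using assms(2) unfolding closed_thin_cover_def by blast
  then obtain D where D: "\<And>i. i \<in> I \<Longrightarrow> countable (D i)"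
    "\<And>i F. i \<in> I \<Longrightarrow> F \<in> D i \<Longrightarrow> cantor_closed F \<and> Sigma03_thin X F"
    "\<And>i. i \<in> I \<Longrightarrow> T i \<subseteq> \<Union>(D i)"
    by metis
  show ?thesis unfolding closed_thin_cover_def
  proof (intro exI conjI)
    show "countable (\<Union>i\<in>I. D i)" using assms(1) D(1) by blast
    show "\<forall>F\<in>\<Union>i\<in>I. D i. cantor_closed F \<and> Sigma03_thin X F" using D(2) by blast
    show "(\<Union>i\<in>I. T i) \<subseteq> \<Union>(\<Union>i\<in>I. D i)" using D(3) by blast
  qed
qed

lemma cover_subset: "closed_thin_cover X T \<Longrightarrow> T' \<subseteq> T \<Longrightarrow> closed_thin_cover X T'"
  unfolding closed_thin_cover_def by (meson order_trans)

lemma cover_Un: "closed_thin_cover X S \<Longrightarrow> closed_thin_cover X T \<Longrightarrow> closed_thin_cover X (S \<union> T)"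
  using cover_countable[of "{S, T}" X "\<lambda>x. x"] by auto

lemma cover_closed_thin: "cantor_closed F \<Longrightarrow> Sigma03_thin X F \<Longrightarrow> closed_thin_cover X F"
  unfolding closed_thin_cover_def by (intro exI[of _ "{F}"]) auto

text \<open>Outside the cover, \<open>C\<close> is a G-delta set contained in \<open>X\<close> and
  so separates itself; the cover is thin because thin sets form a sigma-ideal.\<close>

lemma thin_if_complement_covered:
  assumes C: "cantor_closed C" and cov: "closed_thin_cover X (C - X)"
  shows "Sigma03_thin X C"
proof -
  obtain D where D: "countable D" "\<forall>F\<in>D. cantor_closed F \<and> Sigma03_thin X F" "C - X \<subseteq> \<Union>D"
    using cov unfolding closed_thin_cover_def by blast
  have "Sigma02 (- C \<union> \<Union>D)"
    using C D by (intro Sigma02_Un open_Sigma02 Sigma02_countable) (auto simp: cantor_closed_def)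
  then have "Pi03 (- (C - \<Union>D))" by (simp add: Sigma02_Pi03 Diff_eq Un_commute)
  moreover have "C - \<Union>D \<subseteq> X" using D(3) by blast
  ultimately have "Sigma03_thin X (C - \<Union>D)" unfolding Sigma03_thin_def by blast
  moreover have "Sigma03_thin X (\<Union>D)" using D by (intro thin_countable) auto
  ultimately have "Sigma03_thin X ((C - \<Union>D) \<union> \<Union>D)" by (rule thin_Un)
  then show ?thesis by (rule thin_subset) blast
qed

text \<open>The two local conditions serve two moves: non-thin pieces allow passing to smaller
  kernels, and the density of \<open>B\<close> allows moving towards \<open>B\<close> while still
  meeting \<open>C\<close>.\<close>

definition dense_kernel where
  "dense_kernel X B C \<longleftrightarrow> cantor_closed C \<and> C \<noteq> {} \<and>
    (\<forall>s. nbhd s \<inter> C \<noteq> {} \<longrightarrow> \<not> Sigma03_thin X (nbhd s \<inter> C) \<and> nbhd s \<inter> C \<inter> B \<noteq> {})"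

text \<open>As in the Cantor-Bendixson argument, the countably many basic neighbourhoods on which
  \<open>B \<inter> C\<close> can be covered are removed. The remainder \<open>T'\<close> cannot be
  covered on any neighbourhood that it meets, and its closure \<open>C'\<close> is the kernel: a
  thin piece of \<open>C'\<close> would be a closed thin set covering a piece of
  \<open>T'\<close>.\<close>

lemma dense_kernel_exists:
  assumes C: "cantor_closed C" and ncov: "\<not> closed_thin_cover X (B \<inter> C)"
  shows "\<exists>C'\<subseteq>C. dense_kernel X B C'"
proof -
  define T where "T = B \<inter> C"
  define N where "N = {s. closed_thin_cover X (T \<inter> nbhd s)}"
  define T' where "T' = T - (\<Union>s\<in>N. nbhd s)"
  define C' where "C' = {x. \<forall>n. nbhd (restr x n) \<inter> T' \<noteq> {}}"
  have rest: "closed_thin_cover X (\<Union>s\<in>N. T \<inter> nbhd s)"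
    by (rule cover_countable) (auto simp: N_def)
  have T'_nbhd: "\<not> closed_thin_cover X (T' \<inter> nbhd s)" if "T' \<inter> nbhd s \<noteq> {}" for s
  proof
    assume "closed_thin_cover X (T' \<inter> nbhd s)"
    then have "closed_thin_cover X ((T' \<inter> nbhd s) \<union> (\<Union>s\<in>N. T \<inter> nbhd s))"
      using rest by (rule cover_Un)
    then have "closed_thin_cover X (T \<inter> nbhd s)"
      by (rule cover_subset) (auto simp: T'_def)
    then have "s \<in> N" by (simp add: N_def)
    then show False using that by (auto simp: T'_def)
  qed
  have T'C': "T' \<subseteq> C'" unfolding C'_def using restr_in_nbhd by blast
  have closed: "cantor_closed C'"
    unfolding cantor_closed_def cantor_open_def
  proof
    fix x assume "x \<in> - C'"
    then obtain n where n: "nbhd (restr x n) \<inter> T' = {}" by (auto simp: C'_def)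
    have "y \<notin> C'" if "y \<in> nbhd (restr x n)" for y
    proof -
      have "restr y n = restr x n" using restr_eq_take[OF that] by simp
      then have "nbhd (restr y n) \<inter> T' = {}" using n by simp
      then show ?thesis unfolding C'_def by blast
    qed
    then show "\<exists>n. nbhd (restr x n) \<subseteq> - C'" by blast
  qed
  have meets: "T' \<inter> nbhd s \<noteq> {}" if "nbhd s \<inter> C' \<noteq> {}" for s
  proof -
    obtain x where x: "x \<in> nbhd s" "x \<in> C'" using \<open>nbhd s \<inter> C' \<noteq> {}\<close> by blast
    then have "nbhd (restr x (length s)) \<inter> T' \<noteq> {}" by (auto simp: C'_def)
    then show ?thesis using nbhd_eq_restr[OF x(1)] by auto
  qed
  have "C' \<subseteq> C"
  proof
    fix x assume "x \<in> C'"
    then have "nbhd (restr x n) \<inter> T' \<noteq> {}" for n by (simp add: C'_def)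
    then have "nbhd (restr x n) \<inter> C \<noteq> {}" for n unfolding T'_def T_def by blast
    then have "\<exists>m\<ge>n. nbhd (restr x m) \<inter> C \<noteq> {}" for n by blast
    then show "x \<in> C" by (rule closed_mem[OF C])
  qed
  moreover have "dense_kernel X B C'"
    unfolding dense_kernel_def
  proof (intro conjI allI impI closed)
    have "T' \<noteq> {}"
    proof
      assume "T' = {}"
      then have "T \<subseteq> (\<Union>s\<in>N. T \<inter> nbhd s)" by (auto simp: T'_def)
      from cover_subset[OF rest this] show False using ncov by (simp add: T_def)
    qed
    then show "C' \<noteq> {}" using T'C' by blast
  next
    fix s assume s: "nbhd s \<inter> C' \<noteq> {}"
    show "\<not> Sigma03_thin X (nbhd s \<inter> C')"
    proof
      assume "Sigma03_thin X (nbhd s \<inter> C')"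
      then have "closed_thin_cover X (nbhd s \<inter> C')"
        by (intro cover_closed_thin closed_Int nbhd_closed closed)
      then have "closed_thin_cover X (T' \<inter> nbhd s)"
        by (rule cover_subset) (use T'C' in blast)
      then show False using T'_nbhd meets[OF s] by blast
    qed
    show "nbhd s \<inter> C' \<inter> B \<noteq> {}"
      using meets[OF s] T'C' by (auto simp: T'_def T_def)
  qed
  ultimately show ?thesis by blast
qed

text \<open>If every \<open>B k \<inter> C\<close> were covered, so would be their union
  \<open>C - X\<close>, and \<open>C\<close> would be thin.\<close>

lemma dense_kernel_exists_UN:
  assumes "cantor_closed C" "\<not> Sigma03_thin X C" "- X = (\<Union>k::nat. B k)"
  shows "\<exists>k. \<exists>C'\<subseteq>C. dense_kernel X (B k) C'"
proof (rule ccontr)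
  assume "\<not> ?thesis"
  then have "closed_thin_cover X (B k \<inter> C)" for k
    using dense_kernel_exists[OF assms(1), of X "B k"] by blast
  then have "closed_thin_cover X (\<Union>k. B k \<inter> C)" by (intro cover_countable) auto
  then have "closed_thin_cover X (C - X)"
    by (rule cover_subset) (use assms(3) in blast)
  from thin_if_complement_covered[OF assms(1) this] show False using assms(2) by contradiction
qed

text \<open>The number \<open>n\<close> is the limit inferior of the sequence, finite because the
  sequence does not tend to infinity.\<close>

lemma not_filterlim_nat_at_top:
  assumes "\<not> filterlim (\<alpha> :: nat \<Rightarrow> nat) at_top sequentially"
  shows "\<exists>n T. (\<forall>t\<ge>T. n \<le> \<alpha> t) \<and> (\<forall>t. \<exists>t'\<ge>t. \<alpha> t' = n)"
proof -
  define P where "P n \<longleftrightarrow> (\<forall>T. \<exists>t\<ge>T. \<alpha> t \<le> n)" for n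
  obtain N where "\<forall>T. \<exists>t\<ge>T. \<not> N \<le> \<alpha> t"
    using assms unfolding filterlim_nat_at_top by blast
  then have "P N" unfolding P_def by (meson nat_le_linear)
  define n where "n = (LEAST n. P n)"
  have n: "P n" unfolding n_def by (rule LeastI[of P, OF \<open>P N\<close>])
  have "\<exists>T. \<forall>t\<ge>T. n \<le> \<alpha> t"
  proof (cases n)
    case (Suc m)
    then have "\<not> P m" using not_less_Least[of m P] by (simp add: n_def)
    then show ?thesis unfolding P_def Suc by (meson not_less_eq_eq)
  qed simp
  then obtain T where T: "\<And>t. t \<ge> T \<Longrightarrow> n \<le> \<alpha> t" by blast
  have inf: "\<exists>t'\<ge>t. \<alpha> t' = n" for t
  proof -
    obtain t' where "t' \<ge> max t T" "\<alpha> t' \<le> n" using n unfolding P_def by blast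
    then show ?thesis using T[of t'] by (intro exI[of _ t']) auto
  qed
  show ?thesis using T inf by blast
qed

text \<open>The state of the strategy below is a node \<open>s\<close> and a stack of levels \<open>(k, C, j)\<close>.
  Level \<open>i + 1\<close> lies in some \<open>F i m\<close>, which certifies membership in the \<open>i\<close>-th factor of
  \<open>X = (\<Inter>n. \<Union>m. F n m)\<close>. The move \<open>n\<close> discards all levels above \<open>n\<close> and forces the node
  out of \<open>F k 0, \<dots>, F k j\<close>, so that infinitely many moves \<open>n\<close> drive the branch out of the
  \<open>k\<close>-th factor.\<close>

theorem Pi03_wadge_le_not_Sigma03:
  assumes "Pi03 Y" "Pi03 X" "\<not> Pi03 (- X)"
  shows "wadge_le Y X"
proof -
  obtain F :: "nat \<Rightarrow> nat \<Rightarrow> _" where F: "\<And>n m. cantor_closed (F n m)" "X = (\<Inter>n. \<Union>m. F n m)"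
    using assms(2) unfolding Pi03_closed_family by blast
  define B where "B k = - (\<Union>m. F k m)" for k
  define good where "good k C \<longleftrightarrow> dense_kernel X (B k) C" for k C
  have UN_B: "- X = (\<Union>k. B k)" using F(2) by (simp add: B_def)
  \<comment> \<open>The sets \<open>F n m\<close> cover \<open>X\<close>, so if all their traces on
    \<open>nbhd s \<inter> C\<close> were thin, this set would be thin as well.\<close>
  have push: "\<exists>k' C' m. good k' C' \<and> C' \<subseteq> C \<inter> nbhd s \<inter> F n m"
    if "good k C" "nbhd s \<inter> C \<noteq> {}" for k C s n
  proof -
    have nt: "\<not> Sigma03_thin X (nbhd s \<inter> C)" and cl: "cantor_closed C"
      using that by (auto simp: good_def dense_kernel_def)
    have "\<exists>m. \<not> Sigma03_thin X (nbhd s \<inter> C \<inter> F n m)"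
    proof (rule ccontr)
      assume "\<not> ?thesis"
      then have "Sigma03_thin X (\<Union>m. nbhd s \<inter> C \<inter> F n m)" by (intro thin_UN) blast
      then have "Sigma03_thin X (nbhd s \<inter> C)" by (rule thin_subset) (unfold F(2), blast)
      then show False using nt by blast
    qed
    then obtain m where m: "\<not> Sigma03_thin X (nbhd s \<inter> C \<inter> F n m)" by blast
    have "cantor_closed (nbhd s \<inter> C \<inter> F n m)" by (intro closed_Int nbhd_closed cl F(1))
    from dense_kernel_exists_UN[OF this m UN_B] obtain k' C'
      where "C' \<subseteq> nbhd s \<inter> C \<inter> F n m" "dense_kernel X (B k') C'" by blast
    then show ?thesis unfolding good_def by blast
  qed
  \<comment> \<open>A point of \<open>B k\<close> in \<open>nbhd s \<inter> C\<close> lies outside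
    each closed \<open>F k i\<close>; a long enough initial segment of it avoids the first
    \<open>Suc j\<close> of them at once.\<close>
  have hit: "\<exists>s'. length s < length s' \<and> take (length s) s' = s \<and> nbhd s' \<inter> C \<noteq> {} \<and>
      (\<forall>i\<le>j. nbhd s' \<inter> F k i = {})"
    if "good k C" "nbhd s \<inter> C \<noteq> {}" for k C s j
  proof -
    have "nbhd s \<inter> C \<inter> B k \<noteq> {}"
      using that by (auto simp: good_def dense_kernel_def)
    then obtain x where x: "x \<in> nbhd s" "x \<in> C" "x \<in> B k" by blast
    have "\<exists>n. nbhd (restr x n) \<inter> F k i = {}" for i
      using x(3) by (intro closed_notin F(1)) (auto simp: B_def)
    then obtain n where n: "\<And>i. nbhd (restr x (n i)) \<inter> F k i = {}" by metis
    define M where "M = Max (insert (Suc (length s)) (n ` {..j}))"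
    have M: "length s < M" "\<And>i. i \<le> j \<Longrightarrow> n i \<le> M"
      unfolding M_def Suc_le_eq[symmetric] by (auto simp del: Max_insert intro!: Max_ge)
    have "take (length s) (restr x M) = restr x (length s)"
      using M(1) by (intro restr_eq_take[symmetric]) auto
    also have "\<dots> = s" using restr_eq_take[OF x(1)] by simp
    finally have "take (length s) (restr x M) = s" .
    moreover have "nbhd (restr x M) \<inter> F k i = {}" if "i \<le> j" for i
      using n[of i] nbhd_restr_mono[OF M(2)[OF that], of x] by blast
    moreover have "nbhd (restr x M) \<inter> C \<noteq> {}" using x(2) restr_in_nbhd[of x M] by blast
    ultimately show ?thesis using M(1) by (intro exI[of _ "restr x M"]) simp
  qed
  obtain k0 C0 where k0: "good k0 C0"
  proof -
    have "\<not> Sigma03_thin X UNIV"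
      using assms(3) unfolding Sigma03_thin_def by auto
    from dense_kernel_exists_UN[OF closed_UNIV this UN_B] obtain k C where "dense_kernel X (B k) C"
      by blast
    then show ?thesis by (intro that) (simp add: good_def)
  qed

  define lev where "lev w i = fst (snd (w ! i :: nat \<times> (nat \<Rightarrow> bool) set \<times> nat))" for w i
  define Inv where "Inv = (\<lambda>(s :: bool list, w). w \<noteq> [] \<and>
    (\<forall>i<length w. good (fst (w ! i)) (lev w i)) \<and>
    (\<forall>i. Suc i < length w \<longrightarrow> lev w (Suc i) \<subseteq> lev w i \<and> (\<exists>m. lev w (Suc i) \<subseteq> F i m)) \<and>
    nbhd s \<inter> lev w (length w - 1) \<noteq> {})"
  \<comment> \<open>Here \<open>n'\<close> is the level addressed by the move, cut down to the top
    level if the stack is still too short. The new top level is left open by \<open>R\<close>, since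
    only \<open>Inv\<close> is needed for it.\<close>
  define R where "R = (\<lambda>n (s :: bool list, w) (s', w').
    \<exists>n' k (C :: (nat \<Rightarrow> bool) set) j. n' = min n (length w - 1) \<and> w ! n' = (k, C, j) \<and> length w' = n' + 2 \<and>
      (\<forall>i<n'. w' ! i = w ! i) \<and> w' ! n' = (k, C, Suc j) \<and> (\<forall>i\<le>j. nbhd s' \<inter> F k i = {}))"
  have lev_mono: "lev w i' \<subseteq> lev w i" if "Inv (s, w)" "i \<le> i'" "i' < length w" for s w i i'
    using that(2,3)
  proof (induction rule: dec_induct)
    case (step m)
    then show ?case using that(1) unfolding Inv_def by fastforce
  qed simp
  have Inv_meets: "nbhd s \<inter> lev w i \<noteq> {}" if "Inv (s, w)" "i < length w" for s w i
  proof -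
    have "nbhd s \<inter> lev w (length w - 1) \<noteq> {}" using that(1) by (auto simp: Inv_def)
    moreover have "lev w (length w - 1) \<subseteq> lev w i" using lev_mono[OF that(1)] that(2) by simp
    ultimately show ?thesis by blast
  qed
  show ?thesis
  proof (rule wadge_le_by_strategy[OF assms(1), where h = fst and Inv = Inv and R = R and ?st0.0 = "([], [(k0, C0, 0)])"])
    show "Inv ([], [(k0, C0, 0)])"
      using k0 by (auto simp: Inv_def lev_def nbhd_def good_def dense_kernel_def)
  next
    fix st n assume inv': "Inv st"
    obtain s w where st: "st = (s, w)" by force
    have inv: "Inv (s, w)" using inv' st by simp
    define n' where "n' = min n (length w - 1)"
    have "w \<noteq> []" using inv by (simp add: Inv_def)
    then have n': "n' < length w" unfolding n'_def by (cases w) auto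
    obtain k C j where w: "w ! n' = (k, C, j)" by (metis prod_cases3)
    have C: "lev w n' = C" by (simp add: lev_def w)
    have gC: "good k C" using inv n' w C by (auto simp: Inv_def)
    have "nbhd s \<inter> C \<noteq> {}" using Inv_meets[OF inv n'] C by simp
    from hit[OF gC this] obtain s' where s': "length s < length s'" "take (length s) s' = s"
      "nbhd s' \<inter> C \<noteq> {}" "\<forall>i\<le>j. nbhd s' \<inter> F k i = {}" by blast
    from push[OF gC s'(3), of n'] obtain k' C' m
      where C': "good k' C'" "C' \<subseteq> C \<inter> nbhd s' \<inter> F n' m" by blast
    \<comment> \<open>Level \<open>n'\<close> stays with its counter raised; all levels above it
      give way to one fresh kernel inside \<open>F n' m\<close>.\<close>
    define w' where "w' = take n' w @ [(k, C, Suc j), (k', C', 0)]"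
    have len: "length w' = n' + 2" using n' by (simp add: w'_def)
    have w'_nth: "w' ! i = w ! i" if "i < n'" for i using that n' by (simp add: w'_def nth_append)
    have w'_n': "w' ! n' = (k, C, Suc j)" using n' by (simp add: w'_def nth_append)
    have w'_Suc: "w' ! Suc n' = (k', C', 0)" using n' by (simp add: w'_def nth_append)
    have lev': "lev w' i = lev w i" if "i \<le> n'" for i
      using that w'_nth[of i] w'_n' w by (cases "i = n'") (auto simp: lev_def)
    have levSuc: "lev w' (Suc n') = C'" by (simp add: lev_def w'_Suc)
    have "Inv (s', w')"
      unfolding Inv_def prod.case
    proof (intro conjI allI impI)
      show "w' \<noteq> []" using len by auto
    next
      fix i assume "i < length w'"
      then consider "i < n'" | "i = n'" | "i = Suc n'" using len by linarith
      then show "good (fst (w' ! i)) (lev w' i)"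
      proof cases
        case 1
        then show ?thesis using inv n' lev'[of i] w'_nth[of i] by (auto simp: Inv_def)
      qed (use gC C'(1) w'_n' w'_Suc in \<open>auto simp: lev_def\<close>)
    next
      fix i assume "Suc i < length w'"
      then consider "i < n'" | "i = n'" using len by linarith
      then have "lev w' (Suc i) \<subseteq> lev w' i \<and> (\<exists>m. lev w' (Suc i) \<subseteq> F i m)"
      proof cases
        case 1
        then show ?thesis using inv n' lev'[of i] lev'[of "Suc i"] by (auto simp: Inv_def)
      next
        case 2
        then show ?thesis using levSuc lev'[of n'] C C'(2) by auto
      qed
      then show "lev w' (Suc i) \<subseteq> lev w' i" "\<exists>m. lev w' (Suc i) \<subseteq> F i m" by auto
    next
      have "C' \<noteq> {}" using C'(1) by (auto simp: good_def dense_kernel_def)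
      then show "nbhd s' \<inter> lev w' (length w' - 1) \<noteq> {}" using C'(2) len levSuc by auto
    qed
    moreover have "R n (s, w) (s', w')"
      unfolding R_def prod.case n'_def[symmetric]
      by (intro exI[of _ n'] exI[of _ k] exI[of _ C] exI[of _ j]) (use w len w'_nth w'_n' s'(4) in auto)
    ultimately show "\<exists>st'. Inv st' \<and> R n st st' \<and> length (fst st) < length (fst st') \<and>
        take (length (fst st)) (fst st') = fst st"
      using s' st by (intro exI[of _ "(s', w')"]) auto
  next
    fix \<alpha> \<sigma> y
    assume inv': "\<And>t. Inv (\<sigma> t)" and R': "\<And>t. R (\<alpha> t) (\<sigma> t) (\<sigma> (Suc t))"
      and grow: "\<And>t. length (fst (\<sigma> t)) < length (fst (\<sigma> (Suc t)))" and y: "\<And>t. y \<in> nbhd (fst (\<sigma> t))"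
    define w where "w t = snd (\<sigma> t)" for t
    define m where "m t = min (\<alpha> t) (length (w t) - 1)" for t
    have inv: "Inv (fst (\<sigma> t), w t)" for t using inv'[of t] by (simp add: w_def)
    have R: "length (w (Suc t)) = m t + 2" "\<And>i. i < m t \<Longrightarrow> w (Suc t) ! i = w t ! i"
      "\<exists>k C j. w t ! m t = (k, C, j) \<and> w (Suc t) ! m t = (k, C, Suc j) \<and>
        (\<forall>i\<le>j. nbhd (fst (\<sigma> (Suc t))) \<inter> F k i = {})" for t
      using R'[of t] unfolding R_def by (auto simp: case_prod_beta w_def m_def)
    have len_pos: "length (w t) \<ge> 1" for t using inv[of t] by (auto simp: Inv_def Suc_le_eq)
    have len_sn: "t \<le> length (fst (\<sigma> t))" for t
      by (induction t) (use grow in \<open>auto intro: Suc_leI order.strict_trans1\<close>)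
    \<comment> \<open>Under moves of size at least \<open>n\<close>, each round adds a level or
      leaves at least \<open>n + 2\<close> of them.\<close>
    have high: "length (w t) \<ge> n + 2 \<and> m t \<ge> n" if "\<And>t. t \<ge> T \<Longrightarrow> n \<le> \<alpha> t" "t \<ge> T + n + 1" for n T t
    proof -
      have "length (w (T + i)) \<ge> min (n + 2) (i + 1)" for i
      proof (induction i)
        case (Suc i)
        then show ?case using R(1)[of "T + i"] that(1)[of "T + i"] len_pos[of "T + i"]
          by (auto simp: m_def)
      qed (use len_pos in auto)
      from this[of "t - T"] that show ?thesis by (auto simp: m_def)
    qed
    \<comment> \<open>Rounds acting at level \<open>n\<close> or above preserve the index and the
      closed set of level \<open>n\<close>; only its counter may rise.\<close>
    have keep: "fst (w t ! n) = fst (w T' ! n) \<and> lev (w t) n = lev (w T') n"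
      if "\<And>t. t \<ge> T' \<Longrightarrow> m t \<ge> n" "t \<ge> T'" for n T' t
      using that(2)
    proof (induction rule: dec_induct)
      case (step t)
      have "fst (w (Suc t) ! n) = fst (w t ! n) \<and> lev (w (Suc t)) n = lev (w t) n"
        using R(2)[of n t] R(3)[of t] that(1)[OF step(1)]
        by (cases "m t = n") (auto simp: lev_def)
      then show ?case using step by simp
    qed simp
    show "y \<in> X \<longleftrightarrow> filterlim \<alpha> at_top sequentially"
    proof
      assume lim: "filterlim \<alpha> at_top sequentially"
      show "y \<in> X" unfolding F(2)
      proof
        fix n
        obtain T where T: "\<And>t. t \<ge> T \<Longrightarrow> Suc n \<le> \<alpha> t"
          using lim unfolding filterlim_nat_at_top by blast
        define T' where "T' = T + Suc n + 1"
        \<comment> \<open>Level \<open>Suc n\<close>, not \<open>n\<close>, certifies membership in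
          the \<open>n\<close>-th factor. It is permanent from \<open>T'\<close> on and met by every
          later node, so the branch lies in the closed set \<open>C\<close>.\<close>
        define C where "C = lev (w T') (Suc n)"
        have hi: "length (w t) \<ge> Suc n + 2 \<and> m t \<ge> Suc n" if "t \<ge> T'" for t
          by (rule high[OF T]) (use that in \<open>simp_all add: T'_def\<close>)
        have "good (fst (w T' ! Suc n)) C" "\<exists>i. C \<subseteq> F n i"
          using inv[of T'] hi[of T'] by (auto simp: Inv_def C_def)
        then obtain i where cl: "cantor_closed C" and i: "C \<subseteq> F n i"
          by (auto simp: good_def dense_kernel_def)
        have "y \<in> C"
        proof (rule closed_mem[OF cl])
          fix l
          define t where "t = max l T'"
          have t: "t \<ge> T'" "t \<ge> l" by (auto simp: t_def)
          have "nbhd (fst (\<sigma> t)) \<inter> lev (w t) (Suc n) \<noteq> {}"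
            using hi[OF t(1)] by (intro Inv_meets[OF inv]) auto
          moreover have "lev (w t) (Suc n) = C"
            using keep[of T' "Suc n" t] hi t(1) by (simp add: C_def)
          ultimately have "nbhd (restr y (length (fst (\<sigma> t)))) \<inter> C \<noteq> {}"
            using nbhd_eq_restr[OF y[of t]] by simp
          then show "\<exists>n\<ge>l. nbhd (restr y n) \<inter> C \<noteq> {}"
            using len_sn[of t] t(2) order_trans by blast
        qed
        then show "y \<in> (\<Union>m. F n m)" using i by blast
      qed
    next
      assume yX: "y \<in> X"
      show "filterlim \<alpha> at_top sequentially"
      proof (rule ccontr)
        assume "\<not> filterlim \<alpha> at_top sequentially"
        from not_filterlim_nat_at_top[OF this] obtain n T
          where T: "\<And>t. t \<ge> T \<Longrightarrow> n \<le> \<alpha> t" and inf: "\<And>t. \<exists>t'\<ge>t. \<alpha> t' = n"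
          by blast
        define T' where "T' = T + n + 1"
        have hi: "length (w t) \<ge> n + 2 \<and> m t \<ge> n" if "t \<ge> T'" for t
          by (rule high[OF T]) (use that in \<open>simp_all add: T'_def\<close>)
        \<comment> \<open>The index of level \<open>n\<close> is now permanent. Each of the
          infinitely many moves \<open>n\<close> raises the counter and drives the node out of
          \<open>F k i\<close> for all \<open>i\<close> up to its old value, so the branch lies in
          no \<open>F k i\<close>.\<close>
        define k where "k = fst (w T' ! n)"
        define j where "j t = snd (snd (w t ! n))" for t
        have k: "fst (w t ! n) = k" if "t \<ge> T'" for t
          using keep[of T' n t] hi that by (simp add: k_def)
        have j_hit: "j (Suc t) = Suc (j t) \<and> (\<forall>i\<le>j t. nbhd (fst (\<sigma> (Suc t))) \<inter> F k i = {})"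
          if "t \<ge> T'" "\<alpha> t = n" for t
        proof -
          have "m t = n" using hi[OF that(1)] that(2) by (auto simp: m_def)
          then obtain k' C j' where "w t ! n = (k', C, j')" "w (Suc t) ! n = (k', C, Suc j')"
            "\<forall>i\<le>j'. nbhd (fst (\<sigma> (Suc t))) \<inter> F k' i = {}"
            using R(3)[of t] by blast
          then show ?thesis using k[OF that(1)] by (simp add: j_def)
        qed
        have j_mono: "j t \<le> j (Suc t)" if "t \<ge> T'" for t
          using R(2)[of n t] R(3)[of t] hi[OF that] by (cases "m t = n") (auto simp: j_def)
        have "\<exists>t\<ge>T'. \<alpha> t = n \<and> i \<le> j t" for i
        proof (induction i)
          case 0
          then show ?case using inf by simp
        next
          case (Suc i)
          then obtain t where t: "t \<ge> T'" "\<alpha> t = n" "i \<le> j t" by blast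
          obtain t' where t': "t' \<ge> Suc t" "\<alpha> t' = n" using inf by blast
          have "j (Suc t) \<le> j t'"
            using t'(1)
          proof (induction rule: dec_induct)
            case (step l)
            then show ?case using j_mono[of l] t(1) by simp
          qed simp
          then show ?case using t t' j_hit[OF t(1,2)] by (intro exI[of _ t']) auto
        qed
        then have "y \<notin> F k i" for i
          using j_hit y by (metis disjoint_iff)
        then show False using yX unfolding F(2) by blast
      qed
    qed
  qed
qed

text \<open>Diagonalisation against the universal \<open>\<Sigma>\<^sup>0\<^sub>3\<close> set coded by \<open>x (prod_encode (i, prod_encode (j, s)))\<close>,
  read as \<open>nbhd s \<subseteq> U i j\<close>.\<close>

lemma Pi03_not_Sigma03_exists: "\<exists>D. Pi03 D \<and> \<not> Pi03 (- D)"
proof -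
  define c where "c i j s = prod_encode (i, prod_encode (j, to_nat (s :: bool list)))" for i j s
  define F where "F i j = (\<Inter>s. - ({x. x (c i j s)} \<inter> nbhd s))" for i j
  define D where "D = (\<Inter>i. \<Union>j. F i j)"
  have coord_open: "cantor_open {x. x i}" for i
    unfolding cantor_open_def
  proof
    fix x :: "nat \<Rightarrow> bool" assume "x \<in> {x. x i}"
    then have "nbhd (restr x (Suc i)) \<subseteq> {x. x i}"
      using mem_nbhd_restr[of _ x "Suc i"] by auto
    then show "\<exists>n. nbhd (restr x n) \<subseteq> {x. x i}" by blast
  qed
  have "cantor_closed (F i j)" for i j
    unfolding F_def
    by (intro closed_INT) (simp add: cantor_closed_def del: Compl_Int, intro open_Int coord_open nbhd_open)
  then have "Pi03 D" unfolding Pi03_closed_family D_def by blast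
  moreover have "\<not> Pi03 (- D)"
  proof
    assume "Pi03 (- D)"
    then obtain G :: "nat \<Rightarrow> nat \<Rightarrow> _" where G: "\<And>i j. cantor_closed (G i j)" "- D = (\<Inter>i. \<Union>j. G i j)"
      unfolding Pi03_closed_family by blast
    \<comment> \<open>The point \<open>z\<close> codes the open sets \<open>- G i j\<close>, where
      the \<open>G i j\<close> represent \<open>- D\<close>. Hence \<open>z\<close> lies in
      \<open>D\<close> iff it lies in \<open>- D\<close>.\<close>
    define z where "z p = (let (i, q) = prod_decode p; (j, s) = prod_decode q in
      nbhd (from_nat s :: bool list) \<subseteq> - G i j)" for p
    have z: "z (c i j s) \<longleftrightarrow> nbhd s \<subseteq> - G i j" for i j s
      by (simp add: z_def c_def)
    have "z \<in> F i j \<longleftrightarrow> z \<in> G i j" for i j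
    proof -
      have "z \<in> - G i j \<longleftrightarrow> (\<exists>s. nbhd s \<subseteq> - G i j \<and> z \<in> nbhd s)"
        using open_eq_UN[of "- G i j"] G(1)[of i j] unfolding cantor_closed_def by blast
      then show ?thesis by (auto simp: F_def z)
    qed
    then have "z \<in> D \<longleftrightarrow> z \<in> (\<Inter>i. \<Union>j. G i j)" by (simp add: D_def)
    then show False using G(2) by blast
  qed
  ultimately show ?thesis by blast
qed

section \<open>Densities\<close>

lemma nbhd_eq_emb:
  "nbhd s = prod_emb UNIV (\<lambda>_. measure_pmf (bernoulli_pmf (1/2))) {..<length s}
    (\<Pi>\<^sub>E i\<in>{..<length s}. {s ! i})"
  by (rule set_eqI) (simp add: nbhd_def prod_emb_def PiE_UNIV_domain Pi_iff Ball_def)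

lemma nbhd_sets [measurable, simp]: "nbhd s \<in> sets mu"
  unfolding nbhd_eq_emb mu_def by (rule sets_PiM_I) auto

lemma space_mu [simp]: "space mu = UNIV"
  by (simp add: mu_def space_PiM PiE_UNIV_domain)

interpretation mu: prob_space mu
  unfolding mu_def by (intro prob_space_PiM measure_pmf.prob_space_axioms)

lemma measure_nbhd: "measure mu (nbhd s) = (1/2) ^ length s"
proof -
  interpret product_prob_space "\<lambda>_::nat. measure_pmf (bernoulli_pmf (1/2))" UNIV
    by (intro product_prob_spaceI measure_pmf.prob_space_axioms)
  have "measure mu (nbhd s) = (\<Prod>i\<in>{..<length s}. measure (measure_pmf (bernoulli_pmf (1/2))) {s ! i})"
    unfolding nbhd_eq_emb mu_def by (rule measure_PiM_emb) auto
  also have "\<dots> = (1/2) ^ length s" by (simp add: measure_pmf_single)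
  finally show ?thesis .
qed

lemma measure_nbhd_pos [simp]: "0 < measure mu (nbhd s)"
  by (simp add: measure_nbhd)

lemma open_sets_mu: "cantor_open U \<Longrightarrow> U \<in> sets mu"
  by (subst open_eq_UN) (auto intro!: sets.countable_UN')

lemma closed_sets_mu: "cantor_closed F \<Longrightarrow> F \<in> sets mu"
  using open_sets_mu[of "- F"] sets.compl_sets[of "- F" mu]
  by (simp add: cantor_closed_def Compl_eq_Diff_UNIV double_diff)

text \<open>Induction over the sigma-algebra generated by one-coordinate sets, which are clopen.
  Complementation exchanges the two approximations. For a union all the open sets are joined, but
  only finitely many of the closed ones, which suffices by continuity of the measure from
  above.\<close>

lemma mu_regular:
  assumes "A \<in> sets mu" "0 < e"
  shows "\<exists>U F. cantor_open U \<and> cantor_closed F \<and> F \<subseteq> A \<and> A \<subseteq> U \<and> measure mu (U - F) < e"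
proof -
  have "A \<in> sigma_sets UNIV {{f. f i \<in> A'} | i A'. True}"
    using assms(1) by (simp add: mu_def sets_PiM_single PiE_UNIV_domain)
  then show ?thesis using assms(2)
  proof (induction arbitrary: e)
    case (Basic a)
    then obtain i A' where a: "a = {f. f i \<in> A'}" by blast
    have "cantor_open {f. f i \<in> A'}" for A'
      unfolding cantor_open_def
    proof
      fix x :: "nat \<Rightarrow> bool" assume "x \<in> {f. f i \<in> A'}"
      then have "nbhd (restr x (Suc i)) \<subseteq> {f. f i \<in> A'}"
        using mem_nbhd_restr[of _ x "Suc i"] by auto
      then show "\<exists>n. nbhd (restr x n) \<subseteq> {f. f i \<in> A'}" by blast
    qed
    from this[of A'] this[of "- A'"] have "cantor_open a" "cantor_closed a"
      by (simp_all add: a cantor_closed_def Compl_eq)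
    then show ?case using Basic.prems by (intro exI[of _ a]) simp
  next
    case Empty
    then show ?case by (intro exI[of _ "{}"]) (simp add: cantor_open_def)
  next
    case (Compl a)
    then obtain U F where UF: "cantor_open U" "cantor_closed F" "F \<subseteq> a" "a \<subseteq> U" "measure mu (U - F) < e"
      by blast
    moreover have "- F - - U = U - F" by blast
    ultimately show ?case
      by (intro exI[of _ "- F"] exI[of _ "- U"]) (auto simp: cantor_closed_def)
  next
    case (Union a)
    \<comment> \<open>The errors sum to \<open>e / 2\<close>, which leaves room for passing to the
      finite union \<open>G N\<close>.\<close>
    define d where "d i = e / 2 * (1/2) ^ Suc i" for i
    have "0 < d i" for i using Union.prems by (simp add: d_def)
    then have "\<exists>U F. cantor_open U \<and> cantor_closed F \<and> F \<subseteq> a i \<and> a i \<subseteq> U \<and> measure mu (U - F) < d i" for i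
      by (rule Union.IH)
    then obtain U F where UF: "\<And>i. cantor_open (U i)" "\<And>i. cantor_closed (F i)"
      "\<And>i. F i \<subseteq> a i" "\<And>i. a i \<subseteq> U i" "\<And>i. measure mu (U i - F i) < d i"
      by metis
    have [measurable]: "U i \<in> sets mu" "F i \<in> sets mu" for i
      using UF by (auto intro: open_sets_mu closed_sets_mu)
    define V where "V = (\<Union>i. U i)"
    define G where "G N = (\<Union>i\<in>{..<N}. F i)" for N :: nat
    have [measurable]: "V \<in> sets mu" "G N \<in> sets mu" for N by (auto simp: V_def G_def)
    have d_sums: "d sums (e / 2)"
      using sums_mult[OF power_half_series, of "e / 2"] by (simp add: d_def[abs_def])
    have summ: "summable (\<lambda>i. measure mu (U i - F i))"
      by (rule summable_comparison_test'[OF sums_summable[OF d_sums], of 0])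
        (use UF(5) in \<open>auto intro: less_imp_le\<close>)
    have "measure mu (V - (\<Union>i. F i)) \<le> measure mu (\<Union>i. U i - F i)"
      by (rule mu.finite_measure_mono) (auto simp: V_def)
    also have "\<dots> \<le> (\<Sum>i. measure mu (U i - F i))"
      by (rule mu.finite_measure_subadditive_countably) (use summ in auto)
    also have "\<dots> \<le> (\<Sum>i. d i)"
      by (rule suminf_le) (use UF(5) summ sums_summable[OF d_sums] in \<open>auto intro: less_imp_le\<close>)
    also have "\<dots> = e / 2" using d_sums by (rule sums_unique[symmetric])
    finally have "measure mu (V - (\<Union>i. F i)) < e" using Union.prems by simp
    moreover have "(\<lambda>N. measure mu (V - G N)) \<longlonglongrightarrow> measure mu (\<Inter>N. V - G N)"
      by (rule mu.finite_Lim_measure_decseq) (auto simp: decseq_def G_def)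
    moreover have "(\<Inter>N. V - G N) = V - (\<Union>i. F i)" by (auto simp: G_def)
    ultimately have "\<forall>\<^sub>F N in sequentially. measure mu (V - G N) < e"
      by (auto intro: order_tendstoD)
    then obtain N where "measure mu (V - G N) < e" by (auto simp: eventually_sequentially)
    moreover have "cantor_open V" unfolding V_def by (intro open_UN UF)
    moreover have "cantor_closed (G N)"
      unfolding G_def
    proof (induction N)
      case (Suc N)
      then show ?case using UF(2) by (simp add: lessThan_Suc closed_Un)
    qed simp
    moreover have "G N \<subseteq> (\<Union>i. a i)" "(\<Union>i. a i) \<subseteq> V" 
      unfolding G_def V_def using UF(3,4) by blast+
    ultimately show ?case by blast
  qed
qed

text \<open>The nodes of \<open>S\<close> with no proper initial segment in \<open>S\<close> have
  pairwise disjoint neighbourhoods with the same union, so the local bounds add up.\<close>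

lemma measure_Int_UN_nbhd_le:
  assumes [measurable]: "B \<in> sets mu" and "0 \<le> c"
    and le: "\<And>r. r \<in> S \<Longrightarrow> measure mu (B \<inter> nbhd r) \<le> c * measure mu (nbhd r)"
  shows "measure mu (B \<inter> (\<Union>r\<in>S. nbhd r)) \<le> c * measure mu (\<Union>r\<in>S. nbhd r)"
proof -
  define S' where "S' = {r \<in> S. \<forall>n<length r. take n r \<notin> S}"
  have "\<exists>r'\<in>S'. nbhd r \<subseteq> nbhd r'" if "r \<in> S" for r
  proof -
    define n where "n = (LEAST n. take n r \<in> S)"
    have n: "take n r \<in> S" unfolding n_def by (rule LeastI[of _ "length r"]) (simp add: that)
    have "take m r \<notin> S" if "m < n" for m using not_less_Least[of m] that by (simp add: n_def)
    then have "take n r \<in> S'" using n by (auto simp: S'_def min_def)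
    then show ?thesis using nbhd_take by blast
  qed
  then have UN: "(\<Union>r\<in>S. nbhd r) = (\<Union>r\<in>S'. nbhd r)" by (auto simp: S'_def) blast
  have disj: "disjoint_family_on nbhd S'"
    unfolding disjoint_family_on_def
  proof (intro ballI impI)
    have *: False if "r \<in> S'" "r' \<in> S'" "r \<noteq> r'" "nbhd r \<subseteq> nbhd r'" for r r'
    proof -
      have "length r' \<le> length r" "take (length r') r = r'" using nbhd_subset_length[OF that(4)] by auto
      then show False using that(1-3) unfolding S'_def
        by (metis (mono_tags, lifting) le_neq_implies_less mem_Collect_eq order_refl take_all)
    qed
    fix r r' assume "r \<in> S'" "r' \<in> S'" "r \<noteq> r'"
    then show "nbhd r \<inter> nbhd r' = {}" using *[of r r'] *[of r' r] nbhd_cases[of r r'] by blast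
  qed
  have "emeasure mu (B \<inter> (\<Union>r\<in>S'. nbhd r)) = emeasure mu (\<Union>r\<in>S'. B \<inter> nbhd r)" by simp
  also have "\<dots> = (\<integral>\<^sup>+ r. emeasure mu (B \<inter> nbhd r) \<partial>count_space S')"
    using disj by (intro emeasure_UN_countable) (auto simp: disjoint_family_on_def)
  also have "\<dots> \<le> (\<integral>\<^sup>+ r. ennreal c * emeasure mu (nbhd r) \<partial>count_space S')"
    using le assms(2) by (intro nn_integral_mono)
      (auto simp: S'_def mu.emeasure_eq_measure ennreal_mult'[symmetric] intro!: ennreal_leI)
  also have "\<dots> = ennreal c * (\<integral>\<^sup>+ r. emeasure mu (nbhd r) \<partial>count_space S')"
    by (rule nn_integral_cmult) simp
  also have "(\<integral>\<^sup>+ r. emeasure mu (nbhd r) \<partial>count_space S') = emeasure mu (\<Union>r\<in>S'. nbhd r)"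
    using disj by (intro emeasure_UN_countable[symmetric]) auto
  finally show ?thesis
    using assms(2) unfolding UN by (simp add: mu.emeasure_eq_measure ennreal_mult'[symmetric])
qed

text \<open>A weak form of the Lebesgue density theorem. If all extensions of \<open>s\<close> had
  density at most \<open>c\<close>, the bound would pass to an open superset of \<open>A\<close>
  inside \<open>nbhd s\<close> of nearly the same measure, which is absurd for
  \<open>c < 1\<close>.\<close>

lemma dense_node_exists:
  assumes A [measurable]: "A \<in> sets mu" and "A \<subseteq> nbhd s" and pos: "0 < measure mu A"
    and c: "0 \<le> c" "c < 1"
  shows "\<exists>u. c * measure mu (nbhd (s @ u)) < measure mu (A \<inter> nbhd (s @ u))"
proof (rule ccontr)
  assume "\<not> ?thesis"
  then have le: "measure mu (A \<inter> nbhd (s @ u)) \<le> c * measure mu (nbhd (s @ u))" for u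
    by (simp add: not_less)
  define a where "a = measure mu A"
  \<comment> \<open>With an excess below \<open>(1 - c) * a\<close> the bound yields
    \<open>a \<le> c * (a + (1 - c) * a)\<close>, whose right side is
    \<open>a - (1 - c) * (1 - c) * a\<close>.\<close>
  have "0 < (1 - c) * a" using pos c by (simp add: a_def)
  from mu_regular[OF A this] obtain U F where UF: "cantor_open U" "cantor_closed F" "F \<subseteq> A" "A \<subseteq> U"
    "measure mu (U - F) < (1 - c) * a" by blast
  define V where "V = U \<inter> nbhd s"
  have V: "cantor_open V" unfolding V_def by (intro open_Int UF nbhd_open)
  have [measurable]: "U \<in> sets mu" "F \<in> sets mu" "V \<in> sets mu"
    using UF V by (auto intro: open_sets_mu closed_sets_mu)
  define S where "S = {r. nbhd r \<subseteq> V}"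
  have VS: "(\<Union>r\<in>S. nbhd r) = V" using open_eq_UN[OF V] by (simp add: S_def)
  have "measure mu (A \<inter> nbhd r) \<le> c * measure mu (nbhd r)" if "r \<in> S" for r
  proof -
    have "nbhd r \<subseteq> nbhd s" using that by (auto simp: S_def V_def)
    then have "r = s @ drop (length s) r"
      using nbhd_subset_length by (metis append_take_drop_id)
    then show ?thesis using le by metis
  qed
  then have "measure mu (A \<inter> (\<Union>r\<in>S. nbhd r)) \<le> c * measure mu (\<Union>r\<in>S. nbhd r)"
    by (rule measure_Int_UN_nbhd_le[OF A c(1)])
  then have "measure mu (A \<inter> V) \<le> c * measure mu V" unfolding VS .
  moreover have "A \<inter> V = A" using assms(2) UF(4) by (auto simp: V_def)
  moreover have "measure mu V \<le> measure mu (A \<union> (U - F))"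
    by (rule mu.finite_measure_mono) (use UF in \<open>auto simp: V_def\<close>)
  moreover have "measure mu (A \<union> (U - F)) \<le> a + measure mu (U - F)"
    unfolding a_def by (rule measure_Un_le) auto
  ultimately have "a \<le> c * (a + (1 - c) * a)"
    using UF(5) c(1) by (smt (verit) a_def mult_left_mono)
  moreover have "c * (a + (1 - c) * a) = a - (1 - c) * (1 - c) * a" by (simp add: algebra_simps)
  moreover have "0 < (1 - c) * (1 - c) * a" using c pos by (simp add: a_def)
  ultimately show False by simp
qed

section \<open>Densities at nodes: how far they drop and how they recover\<close>

definition dens :: "(nat \<Rightarrow> bool) set \<Rightarrow> bool list \<Rightarrow> real" where
  "dens B s = measure mu (B \<inter> nbhd s) / measure mu (nbhd s)"

lemma mem_Phi: "x \<in> Phi B \<longleftrightarrow> (\<lambda>n. dens B (restr x n)) \<longlonglongrightarrow> 1"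
  by (simp add: Phi_def dens_def)

lemma dens_le_1: "dens B s \<le> 1"
  by (simp add: dens_def divide_le_eq_1 mu.finite_measure_mono)

lemma dens_le_iff: "dens B s \<le> c \<longleftrightarrow> measure mu (B \<inter> nbhd s) \<le> c * measure mu (nbhd s)"
  by (simp add: dens_def pos_divide_le_eq)

lemma dens_ge_iff: "c \<le> dens B s \<longleftrightarrow> c * measure mu (nbhd s) \<le> measure mu (B \<inter> nbhd s)"
  by (simp add: dens_def pos_le_divide_eq)

lemma dens_less_iff: "dens B s < c \<longleftrightarrow> measure mu (B \<inter> nbhd s) < c * measure mu (nbhd s)"
  using dens_ge_iff[of c B s] by linarith

lemma dens_greater_iff: "c < dens B s \<longleftrightarrow> c * measure mu (nbhd s) < measure mu (B \<inter> nbhd s)"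
  using dens_le_iff[of B s c] by linarith

text \<open>The extreme case is a sibling filled by \<open>B\<close>. In one step the deficit from
  density \<open>1\<close> thus at most doubles.\<close>

lemma dens_child:
  assumes [measurable]: "B \<in> sets mu"
  shows "2 * dens B s - 1 \<le> dens B (s @ [b])"
proof -
  have snoc: "x \<in> nbhd (s @ [b]) \<longleftrightarrow> x \<in> nbhd s \<and> x (length s) = b" for x b
    by (auto simp: nbhd_def nth_append less_Suc_eq)
  have "measure mu (B \<inter> nbhd s) = measure mu ((B \<inter> nbhd (s @ [b])) \<union> (B \<inter> nbhd (s @ [\<not> b])))"
    by (rule arg_cong[where f = "measure mu"]) (auto simp: snoc)
  also have "\<dots> \<le> measure mu (B \<inter> nbhd (s @ [b])) + measure mu (B \<inter> nbhd (s @ [\<not> b]))"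
    by (rule measure_Un_le) auto
  also have "measure mu (B \<inter> nbhd (s @ [\<not> b])) \<le> measure mu (nbhd (s @ [\<not> b]))"
    by (rule mu.finite_measure_mono) auto
  finally show ?thesis by (simp add: dens_def measure_nbhd field_simps)
qed

text \<open>The complement of \<open>B\<close> is non-null in \<open>nbhd s\<close>, so it has
  density above \<open>e\<close> at some node below \<open>s\<close>. At the first node where the
  density of \<open>B\<close> is at most \<open>1 - e\<close>, the predecessor was still above that
  value, and \<open>dens_child\<close> limits the fall.\<close>

lemma dens_dip:
  assumes [measurable]: "B \<in> sets mu" and "dens B s < 1" and e: "0 < e" "e < 1" and "1 - e < dens B s"
  shows "\<exists>u. u \<noteq> [] \<and> dens B (s @ u) \<le> 1 - e \<and> 1 - 2 * e \<le> dens B (s @ u) \<and>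
    (\<forall>n<length u. 1 - e < dens B (s @ take n u))"
proof -
  have diff: "measure mu (nbhd r - B) = measure mu (nbhd r) - measure mu (B \<inter> nbhd r)" for r
    using mu.finite_measure_Diff'[of "nbhd r" B] by (simp add: Int_commute)
  have "0 < measure mu (nbhd s - B)" using assms(2) unfolding diff dens_less_iff by simp
  then obtain u where u: "e * measure mu (nbhd (s @ u)) < measure mu ((nbhd s - B) \<inter> nbhd (s @ u))"
    using dense_node_exists[of "nbhd s - B" s e] e by auto
  moreover have "(nbhd s - B) \<inter> nbhd (s @ u) = nbhd (s @ u) - B" using nbhd_append by blast
  ultimately have "dens B (s @ u) \<le> 1 - e"
    unfolding dens_le_iff using diff[of "s @ u"] by (simp add: algebra_simps)
  then have ex: "dens B (s @ take (length u) u) \<le> 1 - e" by simp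
  define n where "n = (LEAST n. dens B (s @ take n u) \<le> 1 - e)"
  have n: "dens B (s @ take n u) \<le> 1 - e" unfolding n_def by (rule LeastI, rule ex)
  have n_le: "n \<le> length u" unfolding n_def by (rule Least_le, rule ex)
  have small: "1 - e < dens B (s @ take m u)" if "m < n" for m
    using not_less_Least[OF that[unfolded n_def]] by simp
  have "n \<noteq> 0" using n assms(5) by (intro notI) simp
  then obtain m where m: "n = Suc m" using not0_implies_Suc by blast
  have "s @ take n u = (s @ take m u) @ [u ! m]" using n_le m by (simp add: take_Suc_conv_app_nth)
  then have "2 * dens B (s @ take m u) - 1 \<le> dens B (s @ take n u)"
    using dens_child[OF assms(1), of "s @ take m u" "u ! m"] by simp
  then have "1 - 2 * e \<le> dens B (s @ take n u)" using small[of m] m by simp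
  then show ?thesis using n n_le small \<open>n \<noteq> 0\<close>
    by (intro exI[of _ "take n u"]) (auto simp: min_def)
qed

text \<open>The nodes below \<open>s\<close> of density at most \<open>1 - 4 * e\<close> have a
  union \<open>U\<close> on which \<open>B\<close> has average density at most
  \<open>1 - 4 * e\<close>, less than at \<open>s\<close>, so \<open>B - U\<close> is non-null in
  \<open>nbhd s\<close>. The path to a node where this remainder has density above
  \<open>1 - d\<close> avoids all those nodes, since otherwise the final neighbourhood would lie in
  \<open>U\<close>.\<close>

lemma dens_climb:
  assumes [measurable]: "B \<in> sets mu" and e: "0 < e" "4 * e \<le> 1" and "1 - 2 * e \<le> dens B s"
    and d: "0 < d" "d \<le> 1"
  shows "\<exists>u. 1 - d < dens B (s @ u) \<and> (\<forall>n. 1 - 4 * e \<le> dens B (s @ take n u))"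
proof -
  define S where "S = {s @ u | u. dens B (s @ u) \<le> 1 - 4 * e}"
  define U where "U = (\<Union>r\<in>S. nbhd r)"
  have [measurable]: "U \<in> sets mu" unfolding U_def by (auto intro!: sets.countable_UN')
  have U_sub: "U \<subseteq> nbhd s" using nbhd_append by (auto simp: U_def S_def)
  have "measure mu (B \<inter> U) \<le> (1 - 4 * e) * measure mu U"
    unfolding U_def by (rule measure_Int_UN_nbhd_le) (use e in \<open>auto simp: S_def dens_le_iff\<close>)
  also have "\<dots> \<le> (1 - 4 * e) * measure mu (nbhd s)"
    using e U_sub by (intro mult_left_mono mu.finite_measure_mono) auto
  also have "\<dots> < (1 - 2 * e) * measure mu (nbhd s)" using e by simp
  also have "\<dots> \<le> measure mu (B \<inter> nbhd s)" using assms(4) by (simp add: dens_ge_iff)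
  finally have "0 < measure mu (B \<inter> nbhd s) - measure mu (B \<inter> U)" by simp
  also have "\<dots> = measure mu ((B \<inter> nbhd s) - (B \<inter> U))"
    using U_sub by (intro mu.finite_measure_Diff[symmetric]) auto
  finally have pos: "0 < measure mu ((B \<inter> nbhd s) - (B \<inter> U))" .
  obtain u where u: "(1 - d) * measure mu (nbhd (s @ u)) <
      measure mu ((B \<inter> nbhd s - B \<inter> U) \<inter> nbhd (s @ u))"
    using dense_node_exists[of "B \<inter> nbhd s - B \<inter> U" s "1 - d"] pos d by auto
  also have "\<dots> \<le> measure mu (B \<inter> nbhd (s @ u))"
    by (rule mu.finite_measure_mono) auto
  finally have "1 - d < dens B (s @ u)" by (simp add: dens_greater_iff)
  moreover have "1 - 4 * e \<le> dens B (s @ take n u)" for n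
  proof (rule ccontr)
    assume "\<not> 1 - 4 * e \<le> dens B (s @ take n u)"
    then have "s @ take n u \<in> S" unfolding S_def by force
    then have "nbhd (s @ take n u) \<subseteq> U" unfolding U_def by blast
    moreover have "nbhd (s @ u) \<subseteq> nbhd (s @ take n u)"
      using nbhd_append[of "s @ take n u" "drop n u"] by simp
    ultimately have empty: "(B \<inter> nbhd s - B \<inter> U) \<inter> nbhd (s @ u) = {}" by blast
    have "0 \<le> (1 - d) * measure mu (nbhd (s @ u))" using d by simp
    then show False using u unfolding empty by simp
  qed
  ultimately show ?thesis by blast
qed

text \<open>One round of the game: \<open>dens_dip\<close> followed by \<open>dens_climb\<close>,
  ending close enough to density \<open>1\<close> for the next round.\<close>

lemma dens_oscillation:
  assumes "B \<in> sets mu" "\<And>s. dens B s < 1" and e: "0 < e" "4 * e \<le> 1" "1 - e < dens B s"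
    and d: "0 < d" "d \<le> 1"
  shows "\<exists>s'. length s < length s' \<and> take (length s) s' = s \<and> 1 - d < dens B s' \<and>
    (\<forall>n. length s \<le> n \<longrightarrow> n \<le> length s' \<longrightarrow> 1 - 4 * e \<le> dens B (take n s')) \<and>
    (\<exists>n. length s \<le> n \<and> n \<le> length s' \<and> dens B (take n s') \<le> 1 - e)"
proof -
  obtain u where u: "u \<noteq> []" "dens B (s @ u) \<le> 1 - e" "1 - 2 * e \<le> dens B (s @ u)"
    "\<And>n. n < length u \<Longrightarrow> 1 - e < dens B (s @ take n u)"
    using dens_dip[OF assms(1,2), of e s] e by auto
  obtain v where v: "1 - d < dens B ((s @ u) @ v)" "\<And>n. 1 - 4 * e \<le> dens B ((s @ u) @ take n v)"
    using dens_climb[OF assms(1) e(1,2) u(3) d] by blast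
  have "1 - 4 * e \<le> dens B (take n (s @ u @ v))" if "length s \<le> n" for n
  proof (cases "n < length s + length u")
    case True
    then have "take n (s @ u @ v) = s @ take (n - length s) u" using that by simp
    moreover have "1 - e < dens B (s @ take (n - length s) u)" using True that by (intro u(4)) simp
    ultimately show ?thesis using e(1) by simp
  next
    case False
    then have "take n (s @ u @ v) = (s @ u) @ take (n - (length s + length u)) v" by simp
    then show ?thesis by (simp only: v(2))
  qed
  moreover have "take (length (s @ u)) (s @ u @ v) = s @ u" by simp
  ultimately show ?thesis using u(1,2) v(1)
    by (intro exI[of _ "s @ u @ v"] conjI exI[of _ "length (s @ u)"]) auto
qed

section \<open>The complexity of \<open>Phi B\<close>\<close>

lemma Phi_Pi03: "Pi03 (Phi B)"
proof -
  \<comment> \<open>Convergence to \<open>1\<close> is tested against the bounds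
    \<open>1 - 1 / Suc k\<close>; each condition on \<open>dens B (restr x n)\<close> involves
    finitely many bits, so \<open>F k N\<close> is closed.\<close>
  define F where "F k N = {x. \<forall>n\<ge>N. 1 - 1 / Suc k \<le> dens B (restr x n)}" for k N :: nat
  have "cantor_closed (F k N)" for k N
    unfolding cantor_closed_def cantor_open_def
  proof
    fix x assume "x \<in> - F k N"
    then obtain n where n: "n \<ge> N" "\<not> 1 - 1 / Suc k \<le> dens B (restr x n)" by (auto simp: F_def)
    have "y \<in> - F k N" if "y \<in> nbhd (restr x n)" for y
      using restr_eq_take[OF that, of n] n by (auto simp: F_def)
    then show "\<exists>n. nbhd (restr x n) \<subseteq> - F k N" by blast
  qed
  moreover have "Phi B = (\<Inter>k. \<Union>N. F k N)"
  proof (intro equalityI subsetI)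
    fix x assume "x \<in> Phi B"
    then have lim: "(\<lambda>n. dens B (restr x n)) \<longlonglongrightarrow> 1" by (simp add: mem_Phi)
    have "\<exists>N. x \<in> F k N" for k
    proof -
      have "\<forall>\<^sub>F n in sequentially. 1 - 1 / Suc k < dens B (restr x n)"
        by (rule order_tendstoD(1)[OF lim]) simp
      then show ?thesis by (auto simp: F_def eventually_sequentially intro: less_imp_le)
    qed
    then show "x \<in> (\<Inter>k. \<Union>N. F k N)" by blast
  next
    fix x assume x: "x \<in> (\<Inter>k. \<Union>N. F k N)"
    have "(\<lambda>n. dens B (restr x n)) \<longlonglongrightarrow> 1"
    proof (rule order_tendstoI)
      fix a :: real assume "a < 1"
      then obtain k where k: "inverse (real (Suc k)) < 1 - a" using reals_Archimedean[of "1 - a"] by auto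
      obtain N where "x \<in> F k N" using x by blast
      then have "a < dens B (restr x n)" if "n \<ge> N" for n
        using that k by (force simp: F_def inverse_eq_divide)
      then show "\<forall>\<^sub>F n in sequentially. a < dens B (restr x n)" by (auto simp: eventually_sequentially)
    next
      fix a :: real assume "1 < a"
      then show "\<forall>\<^sub>F n in sequentially. dens B (restr x n) < a"
        by (intro always_eventually allI) (rule le_less_trans[OF dens_le_1])
    qed
    then show "x \<in> Phi B" by (simp add: mem_Phi)
  qed
  ultimately show ?thesis unfolding Pi03_closed_family by blast
qed

text \<open>The move \<open>n\<close> is answered by an oscillation of size about
  \<open>\<epsilon> n\<close>. The density along the branch converges to \<open>1\<close> iff the
  oscillations shrink, that is, iff the moves tend to infinity.\<close>

lemma wadge_le_Phi:
  assumes Y: "Pi03 Y" and B: "B \<in> sets mu" and "0 < measure mu B" and dens1: "\<And>s. dens B s < 1"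
  shows "wadge_le Y (Phi B)"
proof -
  \<comment> \<open>The offset \<open>3\<close> keeps \<open>4 * \<epsilon> n\<close> below
    \<open>1\<close>, as \<open>dens_oscillation\<close> requires.\<close>
  define \<epsilon> :: "nat \<Rightarrow> real" where "\<epsilon> n = (1/2) ^ (n + 3)" for n
  have \<epsilon>: "0 < \<epsilon> n" "4 * \<epsilon> n \<le> 1" "\<epsilon> n \<le> 1" for n
    using power_decreasing[of 3 "n + 3" "1/2 :: real"] by (auto simp: \<epsilon>_def power3_eq_cube)
  have \<epsilon>_mono: "\<epsilon> n \<le> \<epsilon> m" if "m \<le> n" for m n
    unfolding \<epsilon>_def by (rule power_decreasing) (use that in auto)
  obtain s0 where s0: "1 - \<epsilon> 0 < dens B s0"
    using dense_node_exists[OF B, of "[]" "1 - \<epsilon> 0"] assms(3) \<epsilon>[of 0]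
    by (auto simp: nbhd_def dens_greater_iff)
  define Inv where "Inv = (\<lambda>(t, s). 1 - \<epsilon> t < dens B s)"
  \<comment> \<open>At time \<open>t\<close> the density is only known to exceed
    \<open>1 - \<epsilon> t\<close>, so a dip to \<open>1 - \<epsilon> n\<close> is guaranteed only
    for \<open>n \<le> t\<close>; hence \<open>min n t\<close>, which is harmless in the
    limit.\<close>
  define R where "R = (\<lambda>n (t, s :: bool list) (t', s'). t' = Suc t \<and>
    (\<forall>i. length s \<le> i \<longrightarrow> i \<le> length s' \<longrightarrow> 1 - 4 * \<epsilon> (min n t) \<le> dens B (take i s')) \<and>
    (\<exists>i. length s \<le> i \<and> i \<le> length s' \<and> dens B (take i s') \<le> 1 - \<epsilon> (min n t)))"
  show ?thesis
  proof (rule wadge_le_by_strategy[OF Y, where h = snd and Inv = Inv and R = R and ?st0.0 = "(0, s0)"])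
    show "Inv (0, s0)" using s0 by (simp add: Inv_def)
  next
    fix st n assume inv: "Inv st"
    obtain t s where st: "st = (t, s)" by force
    have "1 - \<epsilon> (min n t) < dens B s"
      using inv \<epsilon>_mono[of "min n t" t] by (auto simp: st Inv_def)
    from dens_oscillation[OF B dens1 \<epsilon>(1,2) this \<epsilon>(1,3)[of "Suc t"]]
    obtain s' where "length s < length s'" "take (length s) s' = s" "1 - \<epsilon> (Suc t) < dens B s'"
      "\<forall>i. length s \<le> i \<longrightarrow> i \<le> length s' \<longrightarrow> 1 - 4 * \<epsilon> (min n t) \<le> dens B (take i s')"
      "\<exists>i. length s \<le> i \<and> i \<le> length s' \<and> dens B (take i s') \<le> 1 - \<epsilon> (min n t)"
      by blast
    then show "\<exists>st'. Inv st' \<and> R n st st' \<and> length (snd st) < length (snd st') \<and>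
        take (length (snd st)) (snd st') = snd st"
      by (intro exI[of _ "(Suc t, s')"]) (simp add: st Inv_def R_def)
  next
    fix \<alpha> \<sigma> y
    assume \<sigma>0: "\<sigma> 0 = (0, s0)" and R: "\<And>t. R (\<alpha> t) (\<sigma> t) (\<sigma> (Suc t))"
      and grow: "\<And>t. length (snd (\<sigma> t)) < length (snd (\<sigma> (Suc t)))" and y: "\<And>t. y \<in> nbhd (snd (\<sigma> t))"
    define l where "l t = length (snd (\<sigma> t))" for t
    have time: "fst (\<sigma> t) = t" for t
    proof (induction t)
      case (Suc t)
      then show ?case using R[of t] by (auto simp: R_def case_prod_beta)
    qed (simp add: \<sigma>0)
    have take: "take i (snd (\<sigma> t)) = restr y i" if "i \<le> l t" for i t
      using restr_eq_take[OF y] that by (simp add: l_def)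
    have lower: "1 - 4 * \<epsilon> (min (\<alpha> t) t) \<le> dens B (restr y i)" if "l t \<le> i" "i \<le> l (Suc t)" for t i
      using R[of t] that take[OF that(2)] by (auto simp: R_def case_prod_beta time l_def)
    have dip: "\<exists>i\<ge>l t. dens B (restr y i) \<le> 1 - \<epsilon> (min (\<alpha> t) t)" for t
      using R[of t] take[of _ "Suc t"] by (auto simp: R_def case_prod_beta time l_def)
    have l: "strict_mono l" unfolding strict_mono_Suc_iff using grow by (simp add: l_def)
    have l_ge: "t \<le> l t" for t by (rule strict_mono_imp_increasing[OF l])
    show "y \<in> Phi B \<longleftrightarrow> filterlim \<alpha> at_top sequentially"
    proof
      assume "y \<in> Phi B"
      then have lim: "(\<lambda>n. dens B (restr y n)) \<longlonglongrightarrow> 1" by (simp add: mem_Phi)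
      show "filterlim \<alpha> at_top sequentially"
        unfolding filterlim_nat_at_top
      proof
        fix N
        have "\<forall>\<^sub>F n in sequentially. 1 - \<epsilon> N < dens B (restr y n)"
          by (rule order_tendstoD(1)[OF lim]) (simp add: \<epsilon>)
        then obtain T where T: "\<And>n. n \<ge> T \<Longrightarrow> 1 - \<epsilon> N < dens B (restr y n)"
          by (auto simp: eventually_sequentially)
        have "N \<le> \<alpha> t" if "t \<ge> T" for t
        proof (rule ccontr)
          assume "\<not> N \<le> \<alpha> t"
          then have "\<epsilon> N \<le> \<epsilon> (min (\<alpha> t) t)" by (intro \<epsilon>_mono) auto
          moreover obtain i where "i \<ge> l t" "dens B (restr y i) \<le> 1 - \<epsilon> (min (\<alpha> t) t)"
            using dip by blast
          ultimately show False using T[of i] l_ge[of t] that by auto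
        qed
        then show "\<exists>T. \<forall>t\<ge>T. N \<le> \<alpha> t" by blast
      qed
    next
      assume lim: "filterlim \<alpha> at_top sequentially"
      have "(\<lambda>n. dens B (restr y n)) \<longlonglongrightarrow> 1"
      proof (rule order_tendstoI)
        fix a :: real assume "a < 1"
        then obtain N where "(1/2 :: real) ^ N < 1 - a" using real_arch_pow_inv[of "1 - a" "1/2"] by auto
        moreover have "4 * \<epsilon> N \<le> (1/2) ^ N" by (simp add: \<epsilon>_def power_add power3_eq_cube)
        ultimately have N: "4 * \<epsilon> N < 1 - a" by linarith
        obtain T0 where T0: "\<And>t. t \<ge> T0 \<Longrightarrow> N \<le> \<alpha> t"
          using lim unfolding filterlim_nat_at_top by blast
        define T where "T = max T0 N"
        have "a < dens B (restr y n)" if n: "n \<ge> l T" for n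
        proof -
          \<comment> \<open>This is the round whose segment of the branch contains position
            \<open>n\<close>.\<close>
          define t where "t = (GREATEST t. l t \<le> n)"
          have bd: "\<And>t. l t \<le> n \<Longrightarrow> t \<le> n" using l_ge order_trans by blast
          have lt: "l t \<le> n" unfolding t_def by (rule GreatestI_nat[where P = "\<lambda>t. l t \<le> n", OF n bd])
          have "T \<le> t" unfolding t_def by (rule Greatest_le_nat[where P = "\<lambda>t. l t \<le> n", OF n bd])
          have "\<not> l (Suc t) \<le> n"
            using Greatest_le_nat[of "\<lambda>t. l t \<le> n", OF _ bd] unfolding t_def[symmetric]
            by (metis Suc_n_not_le_n)
          then have "1 - 4 * \<epsilon> (min (\<alpha> t) t) \<le> dens B (restr y n)" using lower[OF lt] by simp
          moreover have "\<epsilon> (min (\<alpha> t) t) \<le> \<epsilon> N"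
            using T0[of t] \<open>T \<le> t\<close> by (intro \<epsilon>_mono) (auto simp: T_def)
          ultimately show ?thesis using N by simp
        qed
        then show "\<forall>\<^sub>F n in sequentially. a < dens B (restr y n)" by (auto simp: eventually_sequentially)
      next
        fix a :: real assume "1 < a"
        then show "\<forall>\<^sub>F n in sequentially. dens B (restr y n) < a"
          by (intro always_eventually allI) (rule le_less_trans[OF dens_le_1])
      qed
      then show "y \<in> Phi B" by (simp add: mem_Phi)
    qed
  qed
qed

section \<open>Small dense open sets and the conclusion\<close>

lemma small_open_dense:
  assumes "0 < d"
  shows "\<exists>U. cantor_open U \<and> measure mu U < d \<and> (\<forall>s. \<exists>r. nbhd r \<subseteq> nbhd s \<inter> U)"
proof -
  obtain p where p: "(1/2 :: real) ^ p < d / 2" using real_arch_pow_inv[of "d / 2" "1/2"] assms by auto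
  \<comment> \<open>Every node is some \<open>from_nat k\<close>. Padding it with
    \<open>k + p\<close> bits makes its neighbourhood so small that the measures sum to less than
    \<open>d\<close>.\<close>
  define r where "r k = (from_nat k :: bool list) @ replicate (k + p) True" for k
  define U where "U = (\<Union>k. nbhd (r k))"
  have bound: "measure mu (nbhd (r k)) \<le> (1/2) ^ p * (1/2) ^ k" for k
    unfolding measure_nbhd power_add[symmetric] by (rule power_decreasing) (auto simp: r_def)
  have sums: "(\<lambda>k. (1/2 :: real) ^ p * (1/2) ^ k) sums ((1/2) ^ p * 2)"
    using sums_mult[OF geometric_sums[of "1/2 :: real"], of "(1/2) ^ p"] by simp
  have summ: "summable (\<lambda>k. measure mu (nbhd (r k)))"
    by (rule summable_comparison_test'[OF sums_summable[OF sums], of 0]) (use bound in auto)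
  have "measure mu U \<le> (\<Sum>k. measure mu (nbhd (r k)))"
    unfolding U_def by (rule mu.finite_measure_subadditive_countably) (use summ in auto)
  also have "\<dots> \<le> (\<Sum>k. (1/2) ^ p * (1/2) ^ k)"
    by (rule suminf_le[OF bound summ sums_summable[OF sums]])
  also have "\<dots> = (1/2) ^ p * 2" using sums by (rule sums_unique[symmetric])
  also have "\<dots> < d" using p by simp
  finally have "measure mu U < d" .
  moreover have "cantor_open U" unfolding U_def by (intro open_UN nbhd_open)
  moreover have "\<exists>r. nbhd r \<subseteq> nbhd s \<inter> U" for s
  proof
    have "r (to_nat s) = s @ replicate (to_nat s + p) True" by (simp add: r_def)
    then have "nbhd (r (to_nat s)) \<subseteq> nbhd s" using nbhd_append by metis
    then show "nbhd (r (to_nat s)) \<subseteq> nbhd s \<inter> U" by (auto simp: U_def)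
  qed
  ultimately show ?thesis by blast
qed

text \<open>Up to a null set, \<open>B\<close> misses the non-null set \<open>nbhd r\<close> inside
  \<open>nbhd s\<close>.\<close>

lemma dens_less_1:
  assumes [measurable]: "B \<in> sets mu" and "cantor_open U" and "measure mu (B \<inter> U) = 0"
    and "nbhd r \<subseteq> nbhd s \<inter> U"
  shows "dens B s < 1"
proof -
  have [measurable]: "U \<in> sets mu" using assms(2) by (rule open_sets_mu)
  have "measure mu (B \<inter> nbhd s) \<le> measure mu ((B \<inter> U) \<union> (nbhd s - nbhd r))"
    using assms(4) by (intro mu.finite_measure_mono) auto
  also have "\<dots> \<le> measure mu (B \<inter> U) + measure mu (nbhd s - nbhd r)"
    by (rule measure_Un_le) auto
  also have "measure mu (nbhd s - nbhd r) = measure mu (nbhd s) - measure mu (nbhd r)"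
    using assms(4) by (intro mu.finite_measure_Diff) auto
  also have "measure mu (B \<inter> U) + \<dots> < measure mu (nbhd s)" using assms(3) by simp
  finally show ?thesis by (simp add: dens_less_iff)
qed

text \<open>A \<open>Pi03\<close> set whose complement is not \<open>Pi03\<close> reduces to
  \<open>Phi B\<close>, which therefore cannot be \<open>Delta03\<close>.\<close>

lemma Phi_in_d_Pi03:
  assumes "B \<in> sets mu" "0 < measure mu B" "cantor_open U" "measure mu (B \<inter> U) = 0"
    and "\<And>s. \<exists>r. nbhd r \<subseteq> nbhd s \<inter> U"
  shows "Phi B \<in> d_Pi03"
proof -
  obtain D where D: "Pi03 D" "\<not> Pi03 (- D)" using Pi03_not_Sigma03_exists by blast
  have "dens B s < 1" for s using dens_less_1[OF assms(1,3,4)] assms(5) by blast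
  then have "wadge_le D (Phi B)" by (rule wadge_le_Phi[OF D(1) assms(1,2)])
  then have "\<not> Pi03 (- Phi B)" using Pi03_wadge_le[OF wadge_le_Compl] D(2) by blast
  then show ?thesis by (simp add: d_Pi03_def Delta03_def Phi_Pi03)
qed

theorem theorem1p9:
  shows "is_wadge_degree d_Pi03 \<and> W_dense d_Pi03 \<and>
         (\<forall>e. is_wadge_degree e \<and> W_dense e \<longrightarrow> e = d_Pi03)"
proof -
  \<comment> \<open>Any two members reduce to each other by
    \<open>Pi03_wadge_le_not_Sigma03\<close>; conversely \<open>Pi03\<close> is preserved by
    reductions, for sets and for complements.\<close>
  have degree: "d_Pi03 = {Y. wadge_eq Y X}" if X: "X \<in> d_Pi03" for X
  proof -
    have X': "Pi03 X" "\<not> Pi03 (- X)" using X by (auto simp: d_Pi03_def Delta03_def)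
    have "wadge_eq Y X" if "Y \<in> d_Pi03" for Y
      using that X' by (auto simp: d_Pi03_def Delta03_def wadge_eq_def intro: Pi03_wadge_le_not_Sigma03)
    moreover have "Y \<in> d_Pi03" if "wadge_eq Y X" for Y
    proof -
      have "Pi03 Y" using that X'(1) Pi03_wadge_le by (auto simp: wadge_eq_def)
      moreover have "\<not> Pi03 (- Y)"
        using that X'(2) Pi03_wadge_le[OF wadge_le_Compl[of X Y]] by (auto simp: wadge_eq_def)
      ultimately show ?thesis by (simp add: d_Pi03_def Delta03_def)
    qed
    ultimately show ?thesis by blast
  qed
  have "is_wadge_degree d_Pi03"
  proof -
    obtain D where "Pi03 D" "\<not> Pi03 (- D)" using Pi03_not_Sigma03_exists by blast
    then have "D \<in> d_Pi03" by (simp add: d_Pi03_def Delta03_def)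
    then show ?thesis unfolding is_wadge_degree_def using degree by blast
  qed
  moreover have "W_dense d_Pi03"
    unfolding W_dense_def
  proof (intro ballI impI)
    fix A assume A [measurable]: "A \<in> sets mu" and pos: "0 < measure mu A"
    \<comment> \<open>Removing from \<open>A\<close> a dense open set of smaller measure leaves a
      non-null set disjoint from that open set.\<close>
    obtain U where U: "cantor_open U" "measure mu U < measure mu A"
      "\<And>s. \<exists>r. nbhd r \<subseteq> nbhd s \<inter> U"
      using small_open_dense[OF pos] by blast
    have [measurable]: "U \<in> sets mu" using U(1) by (rule open_sets_mu)
    have "measure mu A \<le> measure mu ((A - U) \<union> U)" by (rule mu.finite_measure_mono) auto
    also have "\<dots> \<le> measure mu (A - U) + measure mu U" by (rule measure_Un_le) auto
    finally have "0 < measure mu (A - U)" using U(2) by simp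
    moreover have "Phi (A - U) \<in> d_Pi03"
      by (rule Phi_in_d_Pi03[OF _ calculation U(1) _ U(3)]) (auto simp: Int_commute)
    moreover have "measure mu (A - U - A) = 0"
      by (metis Diff_eq_empty_iff Diff_subset measure_empty)
    ultimately show "\<exists>B\<in>sets mu. 0 < measure mu B \<and> measure mu (B - A) = 0 \<and> Phi B \<in> d_Pi03"
      by (intro bexI[of _ "A - U"]) simp_all
  qed
  moreover have "e = d_Pi03" if e: "is_wadge_degree e" "W_dense e" for e
  proof -
    \<comment> \<open>The complement of \<open>U\<close> is a test set for \<open>e\<close>: a
      non-null \<open>B\<close> almost contained in it is null on \<open>U\<close>, so
      \<open>Phi B\<close> lies in \<open>e\<close> and in \<open>d_Pi03\<close>, and Wadge degrees
      with a common element coincide.\<close>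
    obtain U where U: "cantor_open U" "measure mu U < 1" "\<And>s. \<exists>r. nbhd r \<subseteq> nbhd s \<inter> U"
      using small_open_dense[of 1] by auto
    have [measurable]: "U \<in> sets mu" using U(1) by (rule open_sets_mu)
    have "0 < measure mu (UNIV - U)" using mu.prob_compl[of U] U(2) by simp
    moreover have "UNIV - U \<in> sets mu" using sets.compl_sets[of U mu] by simp
    ultimately obtain B where B: "B \<in> sets mu" "0 < measure mu B" "measure mu (B - (UNIV - U)) = 0" "Phi B \<in> e"
      using e(2) unfolding W_dense_def by blast
    have "B - (UNIV - U) = B \<inter> U" by blast
    then have "Phi B \<in> d_Pi03" using Phi_in_d_Pi03[OF B(1,2) U(1) _ U(3)] B(3) by simp
    then have d: "d_Pi03 = {Y. wadge_eq Y (Phi B)}" by (rule degree)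
    obtain X where X: "e = {Y. wadge_eq Y X}" using e(1) unfolding is_wadge_degree_def by blast
    have trans: "wadge_le S T \<Longrightarrow> wadge_le T V \<Longrightarrow> wadge_le S V" for S T V
      unfolding wadge_le_def
    proof (elim exE conjE)
      fix f g assume "cantor_continuous f" "S = f -` T" "cantor_continuous g" "T = g -` V"
      then show "\<exists>h. cantor_continuous h \<and> S = h -` V"
        by (intro exI[of _ "g \<circ> f"]) (simp add: cantor_continuous_def vimage_comp[symmetric])
    qed
    have "wadge_eq (Phi B) X" using B(4) X by simp
    then have "wadge_eq Y X \<longleftrightarrow> wadge_eq Y (Phi B)" for Y
      unfolding wadge_eq_def using trans by blast
    then show ?thesis unfolding X d by simp
  qed
  ultimately show ?thesis by blast
qed

end
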